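(* Let $X$ be a Banach space which has an infinite-dimensional separable quotient. Then there is a continuous mapping $f\colon X\to X$ such that the autonomous differential equation $x'=f(x)$ has no solutions; that is, there is no nonempty open interval $I\subset\mathbb{R}$ and mapping $x\colon I\to X$ satisfying $x'(t)=f(x(t))$ for every $t\in I$.
   Context: A quotient of a Banach space $X$ is a space $X/Z$ with $Z\subset X$ a closed subspace, with the quotient norm. Derivatives of $X$-valued mappings are taken with respect to the norm of $X$. Continuity is with respect to the norm topology. *)

theory Defs
  imports "HOL-Analysis.Analysis"
begin

text \<open>The quotient of a normed space by a subspace Z depends on the term Z, so it is not given
  a type: its points are the cosets of Z, and its operations and norm act on sets.\<close>

definition coset :: "'a::real_normed_vector set \<Rightarrow> 'a \<Rightarrow> 'a set" where
  "coset Z x = {x + z | z. z \<in> Z}"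

definition quotient_space :: "'a::real_normed_vector set \<Rightarrow> 'a set set" where
  "quotient_space Z = range (coset Z)"

definition quotient_add :: "'a::real_normed_vector set \<Rightarrow> 'a set \<Rightarrow> 'a set" where
  "quotient_add A B = {a + b | a b. a \<in> A \<and> b \<in> B}"

text \<open>The summand from Z is only needed for c = 0, where the plain dilation of a coset
  collapses to a single point.\<close>

definition quotient_scale :: "'a::real_normed_vector set \<Rightarrow> real \<Rightarrow> 'a set \<Rightarrow> 'a set" where
  "quotient_scale Z c A = {c *\<^sub>R a + z | a z. a \<in> A \<and> z \<in> Z}"

text \<open>The distance from the origin to a coset is the infimum of the norms of its elements;
  see \<open>quotient_norm_eq\<close> below.\<close>

definition quotient_norm :: "'a::real_normed_vector set \<Rightarrow> real" where
  "quotient_norm A = infdist 0 A"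

definition quotient_dist :: "'a::real_normed_vector set \<Rightarrow> 'a set \<Rightarrow> 'a set \<Rightarrow> real" where
  "quotient_dist Z A B = quotient_norm (quotient_add A (quotient_scale Z (-1) B))"

inductive_set quotient_span :: "'a::real_normed_vector set \<Rightarrow> 'a set set \<Rightarrow> 'a set set"
  for Z :: "'a set" and S :: "'a set set" where
  zero: "Z \<in> quotient_span Z S"
| add_scale: "A \<in> S \<Longrightarrow> B \<in> quotient_span Z S \<Longrightarrow>
    quotient_add (quotient_scale Z c A) B \<in> quotient_span Z S"

definition finite_dimensional_quotient :: "'a::real_normed_vector set \<Rightarrow> bool" where
  "finite_dimensional_quotient Z \<longleftrightarrow>
    (\<exists>S. finite S \<and> S \<subseteq> quotient_space Z \<and> quotient_span Z S = quotient_space Z)"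

definition separable_quotient :: "'a::real_normed_vector set \<Rightarrow> bool" where
  "separable_quotient Z \<longleftrightarrow>
    separable_space (Metric_space.mtopology (quotient_space Z) (quotient_dist Z))"

definition has_infinite_dimensional_separable_quotient ::
    "'a::real_normed_vector itself \<Rightarrow> bool" where
  "has_infinite_dimensional_separable_quotient _ \<longleftrightarrow>
    (\<exists>Z :: 'a set. subspace Z \<and> closed Z \<and>
       \<not> finite_dimensional_quotient Z \<and> separable_quotient Z)"

lemma coset_in_quotient_space: "coset Z x \<in> quotient_space Z"
  by (simp add: quotient_space_def)

lemma coset_self: "subspace Z \<Longrightarrow> x \<in> coset Z x"
  by (auto simp: coset_def subspace_0 intro!: exI[of _ 0])

lemma coset_eq_iff:
  assumes "subspace Z"
  shows "coset Z x = coset Z y \<longleftrightarrow> x - y \<in> Z"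
proof
  assume "coset Z x = coset Z y"
  then have "x \<in> coset Z y"
    using coset_self[OF assms] by blast
  then show "x - y \<in> Z"
    by (auto simp: coset_def)
next
  assume *: "x - y \<in> Z"
  have "x + z = y + ((x - y) + z)" "y + z = x + (z - (x - y))" for z
    by (simp_all add: algebra_simps)
  then show "coset Z x = coset Z y"
    unfolding coset_def using subspace_add[OF assms *] subspace_diff[OF assms _ *] by blast
qed

lemma quotient_add_coset:
  assumes "subspace Z"
  shows "quotient_add (coset Z x) (coset Z y) = coset Z (x + y)"
proof (intro set_eqI iffI)
  fix w assume "w \<in> quotient_add (coset Z x) (coset Z y)"
  then obtain u v where "u \<in> Z" "v \<in> Z" "w = (x + u) + (y + v)"
    by (auto simp: quotient_add_def coset_def)
  then have "w = (x + y) + (u + v)" "u + v \<in> Z"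
    using subspace_add[OF assms] by (auto simp: algebra_simps)
  then show "w \<in> coset Z (x + y)"
    unfolding coset_def by blast
next
  fix w assume "w \<in> coset Z (x + y)"
  then obtain z where "z \<in> Z" "w = x + (y + z)"
    by (auto simp: coset_def algebra_simps)
  then show "w \<in> quotient_add (coset Z x) (coset Z y)"
    using coset_self[OF assms, of x] unfolding quotient_add_def coset_def by blast
qed

lemma quotient_scale_coset:
  assumes "subspace Z"
  shows "quotient_scale Z c (coset Z x) = coset Z (c *\<^sub>R x)"
proof (intro set_eqI iffI)
  fix w assume "w \<in> quotient_scale Z c (coset Z x)"
  then obtain u v where "u \<in> Z" "v \<in> Z" "w = c *\<^sub>R (x + u) + v"
    by (auto simp: quotient_scale_def coset_def)
  then have "w = c *\<^sub>R x + (c *\<^sub>R u + v)" "c *\<^sub>R u + v \<in> Z"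
    using subspace_add[OF assms] subspace_scale[OF assms] by (auto simp: algebra_simps)
  then show "w \<in> coset Z (c *\<^sub>R x)"
    unfolding coset_def by blast
next
  fix w assume "w \<in> coset Z (c *\<^sub>R x)"
  then show "w \<in> quotient_scale Z c (coset Z x)"
    using coset_self[OF assms, of x] unfolding quotient_scale_def
    by (auto simp: coset_def[of Z "c *\<^sub>R x"])
qed

lemma quotient_norm_eq: "A \<noteq> {} \<Longrightarrow> quotient_norm A = (INF a\<in>A. norm a)"
  by (simp add: quotient_norm_def infdist_notempty)

lemma quotient_norm_coset:
  assumes "subspace Z"
  shows "quotient_norm (coset Z x) = infdist x Z"
proof -
  have ne: "Z \<noteq> {}" "coset Z x \<noteq> {}"
    using subspace_0[OF assms] coset_self[OF assms, of x] by auto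
  have "norm ` coset Z x = dist x ` Z"
  proof (intro set_eqI iffI)
    fix r assume "r \<in> norm ` coset Z x"
    then obtain z where "z \<in> Z" "r = norm (x + z)"
      by (auto simp: coset_def)
    then show "r \<in> dist x ` Z"
      using subspace_neg[OF assms, of z] by (intro image_eqI[of _ _ "- z"]) (auto simp: dist_norm)
  next
    fix r assume "r \<in> dist x ` Z"
    then obtain z where "z \<in> Z" "r = norm (x + (- z))"
      by (auto simp: dist_norm)
    then show "r \<in> norm ` coset Z x"
      using subspace_neg[OF assms, of z] unfolding coset_def by blast
  qed
  with ne show ?thesis
    by (simp add: quotient_norm_eq infdist_notempty)
qed

lemma quotient_dist_coset:
  assumes "subspace Z"
  shows "quotient_dist Z (coset Z x) (coset Z y) = infdist (x - y) Z"
  by (simp add: quotient_dist_def quotient_scale_coset quotient_add_coset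
      quotient_norm_coset assms)

lemma quotient_dist_commute:
  assumes "subspace Z"
  shows "quotient_dist Z A B = quotient_dist Z B A"
proof -
  define D where "D A B = quotient_add A (quotient_scale Z (-1) B)" for A B
  have sub: "uminus ` D A B \<subseteq> D B A" for A B
  proof
    fix w assume "w \<in> uminus ` D A B"
    then obtain a b z where *: "a \<in> A" "b \<in> B" "z \<in> Z" "w = - (a + ((-1) *\<^sub>R b + z))"
      by (auto simp: D_def quotient_add_def quotient_scale_def)
    then have "w = b + ((-1) *\<^sub>R a + (- z))" "- z \<in> Z"
      using subspace_neg[OF assms] by (auto simp: algebra_simps)
    with * show "w \<in> D B A"
      unfolding D_def quotient_add_def quotient_scale_def by blast
  qed
  have "D B A \<subseteq> uminus ` D A B"
    using image_mono[OF sub[of B A], of uminus] by (simp add: image_image)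
  then have eq: "D B A = uminus ` D A B"
    using sub[of A B] by blast
  have "norm ` D B A = norm ` D A B"
    by (simp add: eq image_image)
  then show ?thesis
    unfolding quotient_dist_def quotient_norm_def D_def[symmetric]
    by (auto simp: infdist_def eq)
qed

text \<open>Hence the topology in \<open>separable_quotient\<close> is that of a genuine metric.\<close>

lemma Metric_space_quotient:
  assumes Z: "subspace Z" "closed Z"
  shows "Metric_space (quotient_space Z) (quotient_dist Z)"
proof
  show "0 \<le> quotient_dist Z A B" for A B
    by (simp add: quotient_dist_def quotient_norm_def infdist_nonneg)
  show "quotient_dist Z A B = quotient_dist Z B A" for A B
    by (rule quotient_dist_commute[OF Z(1)])
  have ne: "Z \<noteq> {}"
    using subspace_0[OF Z(1)] by auto
  show "quotient_dist Z A B = 0 \<longleftrightarrow> A = B"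
    if AB: "A \<in> quotient_space Z" "B \<in> quotient_space Z" for A B
  proof -
    obtain x y where xy: "A = coset Z x" "B = coset Z y"
      using AB by (auto simp: quotient_space_def)
    show ?thesis
      by (simp only: xy quotient_dist_coset[OF Z(1)] coset_eq_iff[OF Z(1)]
          in_closed_iff_infdist_zero[OF Z(2) ne])
  qed
  show "quotient_dist Z A C \<le> quotient_dist Z A B + quotient_dist Z B C"
    if ABC: "A \<in> quotient_space Z" "B \<in> quotient_space Z" "C \<in> quotient_space Z" for A B C
  proof -
    obtain x y w where xyw: "A = coset Z x" "B = coset Z y" "C = coset Z w"
      using ABC by (auto simp: quotient_space_def)
    have "infdist (x - w) Z \<le> infdist (x - y) Z + infdist (y - w) Z"
    proof (rule field_le_epsilon)
      fix e :: real assume "0 < e"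
      then have near: "\<exists>z\<in>Z. dist a z < infdist a Z + e / 2" for a
        using cInf_lessD[of "dist a ` Z" "infdist a Z + e / 2"] ne
        by (auto simp: infdist_notempty)
      obtain u where u: "u \<in> Z" "dist (x - y) u < infdist (x - y) Z + e / 2"
        using near by blast
      obtain v where v: "v \<in> Z" "dist (y - w) v < infdist (y - w) Z + e / 2"
        using near by blast
      have "infdist (x - w) Z \<le> dist (x - w) (u + v)"
        using u v by (intro infdist_le subspace_add[OF Z(1)])
      also have "\<dots> \<le> dist (x - y) u + dist (y - w) v"
        using norm_triangle_ineq[of "x - y - u" "y - w - v"] by (simp add: dist_norm algebra_simps)
      finally show "infdist (x - w) Z \<le> infdist (x - y) Z + infdist (y - w) Z + e"
        using u v by linarith
    qed
    then show ?thesis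
      by (simp add: xyw quotient_dist_coset Z)
  qed
qed

end

theory Submission
  imports Defs
begin

text \<open>A separable infinite-dimensional quotient of \<open>X\<close> yields closed subspaces
  \<open>E 0 \<subseteq> E 1 \<subseteq> \<dots>\<close> of \<open>X\<close> with dense union, so the distances \<open>p n x\<close> of \<open>x\<close> to \<open>E n\<close> decrease
  to 0, and a vector \<open>v\<close> outside all of them. Let \<open>T n = root (Suc M) (p n)\<close>. Modulo \<open>E n\<close> the field
  is \<open>lam n x *\<^sub>R x + v\<close> up to an error of at most \<open>T n x ^ M / 8\<close>, where \<open>\<bar>lam n x\<bar> \<le> 1 / T n x\<close>.
  If \<open>lam n\<close> is close to \<open>1 / T n\<close> along a solution, then \<open>T n\<close> grows at a rate that does not
  depend on \<open>n\<close>; if this happens for infinitely many \<open>n\<close>, it contradicts that \<open>T n\<close> tends to 0 as \<open>n\<close>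
  grows. If \<open>lam n\<close> is close to \<open>- 1 / T n\<close>, the same holds backwards in time.

  The sign of \<open>lam n\<close> is read off from functionals \<open>h n\<close> that vanish on \<open>E n\<close> and norm \<open>v\<close> modulo
  \<open>E n\<close>. The field is such that \<open>h n\<close> satisfies the exact equation \<open>y' = lam n * y + p n v\<close> along
  solutions, whence \<open>h n\<close> increases through a window around 0. So at any time either infinitely many \<open>h n\<close>
  are not below their window, and these are above it soon after and forever, or almost all \<open>h n\<close> are below
  it, and have always been.\<close>

section \<open>Continuity and growth\<close>

text \<open>Instead of uniform convergence, the error bounds are continuous at \<open>x\<close> and
  tend to 0 there: once \<open>r n x\<close> is small for a fixed \<open>n\<close>,
  \<open>r n y\<close> is small for all \<open>y\<close> near \<open>x\<close>.\<close>

lemma isCont_approx: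
  fixes F :: "'a::t2_space \<Rightarrow> 'b::real_normed_vector"
  assumes S: "\<And>n::nat. isCont (S n) x" and r: "\<And>n. isCont (r n) x" "(\<lambda>n. r n x) \<longlonglongrightarrow> 0"
    and bd: "\<And>n. \<forall>\<^sub>F y in nhds x. norm (F y - S n y) \<le> r n y"
  shows "isCont F x"
  unfolding isCont_def
proof (rule tendstoI)
  fix e :: real assume "e > 0"
  then obtain n where n: "r n x < e / 4"
    using order_tendstoD(2)[OF r(2), of "e / 4"] by (auto simp: eventually_sequentially)
  have "\<forall>\<^sub>F y in at x. r n y < e / 4"
    using order_tendstoD(2)[OF r(1)[of n, unfolded isCont_def] n] .
  moreover have "\<forall>\<^sub>F y in at x. dist (S n y) (S n x) < e / 4"
    by (rule tendstoD[OF S[of n, unfolded isCont_def]]) (use \<open>e > 0\<close> in simp)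
  moreover have "\<forall>\<^sub>F y in at x. norm (F y - S n y) \<le> r n y"
    using bd[of n] by (simp add: eventually_at_filter eventually_mono)
  ultimately show "\<forall>\<^sub>F y in at x. dist (F y) (F x) < e"
  proof eventually_elim
    case (elim y)
    have "norm (F x - S n x) \<le> r n x"
      by (rule eventually_nhds_x_imp_x[OF bd])
    moreover have "F y - F x = (F y - S n y) + (S n y - S n x) - (F x - S n x)"
      by simp
    then have "norm (F y - F x) \<le> norm (F y - S n y) + norm (S n y - S n x) + norm (F x - S n x)"
      by (metis norm_triangle_ineq norm_triangle_ineq4 add_right_mono order_trans)
    ultimately show ?case
      using elim n \<open>e > 0\<close> by (simp add: dist_norm)
  qed
qed

text \<open>Continuous induction: the set of \<open>s\<close> at which the bound holds is closed,
  and \<open>step\<close> leads beyond its supremum unless that is \<open>t\<close>. One-sided steps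
  in place of derivatives make this applicable to \<open>T n\<close> along a solution.\<close>

lemma continuous_linear_growth:
  fixes g :: "real \<Rightarrow> real"
  assumes "a \<le> t" and cont: "continuous_on {a..t} g"
    and step: "\<And>s. a \<le> s \<Longrightarrow> s < t \<Longrightarrow> g a + k * (s - a) \<le> g s \<Longrightarrow>
      \<forall>\<^sub>F h in at_right 0. g s + k * h \<le> g (s + h)"
  shows "g a + k * (t - a) \<le> g t"
proof -
  define A where "A = {s \<in> {a..t}. g a + k * (s - a) \<le> g s}"
  have "closed A"
    unfolding A_def by (intro continuous_on_closed_Collect_le continuous_intros cont closed_atLeastAtMost)
  have "a \<in> A" "bdd_above A"
    using \<open>a \<le> t\<close> by (auto simp: A_def intro!: bdd_aboveI[of _ t])
  define c where "c = Sup A"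
  have "c \<in> A"
    unfolding c_def using closed_contains_Sup[OF _ \<open>bdd_above A\<close> \<open>closed A\<close>] \<open>a \<in> A\<close> by blast
  then have c: "a \<le> c" "c \<le> t" "g a + k * (c - a) \<le> g c"
    by (auto simp: A_def)
  have "c = t"
  proof (rule ccontr)
    assume "c \<noteq> t"
    with c have "c < t" by simp
    have "\<forall>\<^sub>F h in at_right 0. h \<in> {0<..<t - c}"
      using \<open>c < t\<close> by (intro eventually_at_right_real) simp
    with step[OF c(1) \<open>c < t\<close> c(3)]
    have "\<forall>\<^sub>F h in at_right 0. g c + k * h \<le> g (c + h) \<and> h \<in> {0<..<t - c}"
      by (rule eventually_conj)
    then obtain h where h: "g c + k * h \<le> g (c + h)" "0 < h" "h < t - c"
      using eventually_happens'[OF trivial_limit_at_right_real] by auto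
    then have "c + h \<in> A"
      using c by (auto simp: A_def algebra_simps)
    then show False
      using cSup_upper[OF _ \<open>bdd_above A\<close>] h(2) by (force simp: c_def)
  qed
  with c show ?thesis by simp
qed

text \<open>The derivative has to exceed \<open>k\<close> only where the bound holds already, so an
  estimate valid only in a region can sustain itself, as in \<open>h_persistent\<close>.\<close>

lemma derivative_linear_growth:
  fixes y D :: "real \<Rightarrow> real"
  assumes "a \<le> t"
    and deriv: "\<And>s. s \<in> {a..t} \<Longrightarrow> (y has_real_derivative D s) (at s)"
    and D: "\<And>s. s \<in> {a..t} \<Longrightarrow> y a + k * (s - a) \<le> y s \<Longrightarrow> k < D s"
  shows "y a + k * (t - a) \<le> y t"
proof (rule continuous_linear_growth[OF \<open>a \<le> t\<close>])
  show "continuous_on {a..t} y"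
    using deriv by (meson DERIV_isCont continuous_at_imp_continuous_on)
  fix s assume s: "a \<le> s" "s < t" "y a + k * (s - a) \<le> y s"
  then have "((\<lambda>h. (y (s + h) - y s) / h) \<longlongrightarrow> D s) (at_right 0)"
    using deriv[of s] by (auto simp: DERIV_def intro: filterlim_mono[OF _ order_refl at_le])
  moreover have "k < D s"
    using D s by simp
  ultimately have "\<forall>\<^sub>F h in at_right 0. k < (y (s + h) - y s) / h"
    by (rule order_tendstoD)
  moreover have "\<forall>\<^sub>F h in at_right (0::real). 0 < h"
    by (rule eventually_at_right_less)
  ultimately show "\<forall>\<^sub>F h in at_right 0. y s + k * h \<le> y (s + h)"
    by eventually_elim (simp add: field_simps)
qed

section \<open>The Hahn-Banach theorem\<close>

text \<open>Homogeneity is stated as an inequality for positive \<open>c\<close>; applying it to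
  \<open>inverse c\<close> as well gives the equality in \<open>sublinear_scale\<close>.\<close>

definition sublinear :: "('a::real_vector \<Rightarrow> real) \<Rightarrow> bool" where
  "sublinear p \<longleftrightarrow> (\<forall>x y. p (x + y) \<le> p x + p y) \<and> (\<forall>c x. 0 < c \<longrightarrow> p (c *\<^sub>R x) \<le> c * p x)"

lemma sublinear_add: "sublinear p \<Longrightarrow> p (x + y) \<le> p x + p y"
  by (simp add: sublinear_def)

lemma sublinear_scale:
  assumes "sublinear p" "0 \<le> c"
  shows "p (c *\<^sub>R x) = c * p x"
proof -
  have le: "p (c *\<^sub>R x) \<le> c * p x" if "0 < c" for c x
    using assms that by (simp add: sublinear_def)
  have "p 0 = 0"
    using le[of 2 0] le[of "1/2" 0] by simp
  moreover have "p (c *\<^sub>R x) = c * p x" if "0 < c"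
    using le[OF that, of x] le[of "inverse c" "c *\<^sub>R x"] that by (simp add: field_simps)
  ultimately show ?thesis
    using assms(2) by (cases "c = 0") auto
qed

lemma sublinear_zero: "sublinear p \<Longrightarrow> p 0 = 0"
  using sublinear_scale[of p 0 0] by simp

lemma sublinear_lower: "sublinear p \<Longrightarrow> - p (- x) \<le> p x"
  using sublinear_add[of p x "- x"] sublinear_zero[of p] by simp

text \<open>The values \<open>q x\<close> are bounded below by \<open>- p (- x)\<close>, so the
  infimum is finite. For subadditivity, two members of the chain are replaced by the smaller
  one.\<close>

lemma sublinear_INF_chain:
  assumes C: "C \<noteq> {}" "\<forall>q\<in>C. sublinear q \<and> q \<le> p"
    and chain: "\<forall>q\<in>C. \<forall>r\<in>C. q \<le> r \<or> r \<le> q"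
  shows "sublinear (\<lambda>x. INF q\<in>C. q x)" and "q \<in> C \<Longrightarrow> (INF q\<in>C. q x) \<le> q x"
proof -
  have bdd: "bdd_below ((\<lambda>q. q x) ` C)" for x
  proof (rule bdd_belowI2[of _ "- p (- x)"])
    fix q assume "q \<in> C"
    then show "- p (- x) \<le> q x"
      using C(2) sublinear_lower[of q x] by (smt (verit) le_funD)
  qed
  have low: "(INF q\<in>C. q x) \<le> q x" if "q \<in> C" for q x
    by (rule cINF_lower[OF bdd that])
  then show "q \<in> C \<Longrightarrow> (INF q\<in>C. q x) \<le> q x" .
  let ?u = "\<lambda>x. INF q\<in>C. q x"
  have "?u (x + y) \<le> ?u x + ?u y" for x y
  proof -
    have pair: "?u (x + y) \<le> q x + r y" if qr: "q \<in> C" "r \<in> C" for q r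
    proof -
      obtain s where s: "s \<in> C" "s \<le> q" "s \<le> r"
        using chain qr by blast
      have "?u (x + y) \<le> s x + s y"
        using low[OF s(1)] sublinear_add[of s x y] C(2) s(1) order_trans by blast
      then show ?thesis
        using s by (smt (verit) le_funD)
    qed
    have "?u (x + y) - r y \<le> ?u x" if "r \<in> C" for r
      by (rule cINF_greatest[OF C(1)]) (use pair that in \<open>auto simp: algebra_simps\<close>)
    then have "?u (x + y) - ?u x \<le> ?u y"
      by (intro cINF_greatest[OF C(1)]) (auto simp: algebra_simps)
    then show ?thesis by simp
  qed
  moreover have "?u (c *\<^sub>R x) \<le> c * ?u x" if "0 < c" for c x
  proof -
    have "?u (c *\<^sub>R x) / c \<le> ?u x"
    proof (rule cINF_greatest[OF C(1)])
      fix q assume "q \<in> C"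
      then show "?u (c *\<^sub>R x) / c \<le> q x"
        using low[of q "c *\<^sub>R x"] sublinear_scale[of q c x] C(2) that by (simp add: field_simps)
    qed
    then show ?thesis using that by (simp add: field_simps)
  qed
  ultimately show "sublinear ?u"
    by (simp add: sublinear_def)
qed

text \<open>\<open>q' y\<close> lowers \<open>q\<close> along \<open>y\<close>: \<open>t = 0\<close>
  gives \<open>q' y x \<le> q x\<close>, and \<open>t = 1\<close> gives
  \<open>q' y (- y) \<le> - q y\<close>, which forces linear functionals below \<open>q' y\<close>
  to agree with \<open>q\<close> at \<open>y\<close>.\<close>

lemma sublinear_directional:
  assumes q: "sublinear q"
  defines "q' \<equiv> \<lambda>y x. INF t\<in>{0..}. q (x + t *\<^sub>R y) - t * q y"
  shows "sublinear (q' y)" and "0 \<le> t \<Longrightarrow> q' y x \<le> q (x + t *\<^sub>R y) - t * q y"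
proof -
  have bdd: "bdd_below ((\<lambda>t. q (x + t *\<^sub>R y) - t * q y) ` {0..})" for x
  proof (rule bdd_belowI2[of _ "- q (- x)"])
    fix t :: real assume "t \<in> {0..}"
    then show "- q (- x) \<le> q (x + t *\<^sub>R y) - t * q y"
      using sublinear_add[OF q, of "x + t *\<^sub>R y" "- x"] sublinear_scale[OF q, of t y] by simp
  qed
  show low: "q' y x \<le> q (x + t *\<^sub>R y) - t * q y" if "0 \<le> t" for t x
    unfolding q'_def by (rule cINF_lower[OF bdd]) (use that in simp)
  have great: "c \<le> q' y x" if "\<And>t. 0 \<le> t \<Longrightarrow> c \<le> q (x + t *\<^sub>R y) - t * q y" for c x
    unfolding q'_def by (rule cINF_greatest) (use that in auto)
  have "q' y (x + z) \<le> q' y x + q' y z" for x z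
  proof -
    have pair: "q' y (x + z) \<le> (q (x + s *\<^sub>R y) - s * q y) + (q (z + t *\<^sub>R y) - t * q y)"
      if "0 \<le> s" "0 \<le> t" for s t
      using low[of "s + t" "x + z"] sublinear_add[OF q, of "x + s *\<^sub>R y" "z + t *\<^sub>R y"] that
      by (simp add: algebra_simps)
    have "q' y (x + z) - (q (z + t *\<^sub>R y) - t * q y) \<le> q' y x" if "0 \<le> t" for t
      by (rule great) (use pair[OF _ that] in \<open>simp add: algebra_simps\<close>)
    then have "q' y (x + z) - q' y x \<le> q' y z"
      by (intro great) (simp add: algebra_simps)
    then show ?thesis by simp
  qed
  moreover have "q' y (c *\<^sub>R x) \<le> c * q' y x" if "0 < c" for c x
  proof -
    have "q' y (c *\<^sub>R x) / c \<le> q' y x"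
    proof (rule great)
      fix t :: real assume "0 \<le> t"
      then show "q' y (c *\<^sub>R x) / c \<le> q (x + t *\<^sub>R y) - t * q y"
        using low[of "c * t" "c *\<^sub>R x"] sublinear_scale[OF q, of c "x + t *\<^sub>R y"] that
        by (simp add: field_simps scaleR_add_right)
    qed
    then show ?thesis using that by (simp add: field_simps)
  qed
  ultimately show "sublinear (q' y)"
    by (simp add: sublinear_def)
qed

text \<open>Zorn's lemma is applied to sublinear functionals instead of partially defined linear ones.\<close>

lemma minimal_sublinear_linear:
  assumes q: "sublinear q" and min: "\<And>r. sublinear r \<Longrightarrow> r \<le> q \<Longrightarrow> r = q"
  shows "linear q"
proof -
  have add: "q (x + y) = q x + q y" for x y
  proof (rule antisym[OF sublinear_add[OF q]])
    let ?r = "\<lambda>x. INF t\<in>{0..}. q (x + t *\<^sub>R y) - t * q y"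
    note r = sublinear_directional[OF q, where y = y]
    \<comment> \<open>Minimality excludes a proper decrease, so \<open>t = 1\<close> yields the
      reverse of subadditivity.\<close>
    have "?r = q"
      by (rule min[OF r(1)]) (use r(2)[of 0] in \<open>simp add: le_fun_def\<close>)
    then show "q x + q y \<le> q (x + y)"
      using r(2)[of 1 x] by (simp add: fun_eq_iff)
  qed
  have neg: "q (- x) = - q x" for x
    using add[of x "- x"] sublinear_zero[OF q] by simp
  have "q (c *\<^sub>R x) = c *\<^sub>R q x" for c x
    using sublinear_scale[OF q, of c x] sublinear_scale[OF q, of "- c" x] neg[of "c *\<^sub>R x"]
    by (cases "0 \<le> c") auto
  with add show ?thesis
    by (rule linearI)
qed

lemma ex_minimal_sublinear:
  assumes p: "sublinear p"
  shows "\<exists>q. sublinear q \<and> q \<le> p \<and> (\<forall>r. sublinear r \<longrightarrow> r \<le> q \<longrightarrow> r = q)"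
proof -
  define A where "A = {q. sublinear q \<and> q \<le> p}"
  have "\<exists>m\<in>A. \<forall>a\<in>A. a \<le> m \<longrightarrow> a = m"
  proof (rule predicate_Zorn[where P = "\<lambda>x y. y \<le> x", simplified])
    show "partial_order_on A (relation_of (\<lambda>x y. y \<le> x) A)"
      by (auto simp: partial_order_on_def preorder_on_def refl_on_def trans_def antisym_def
          relation_of_def)
    fix C assume "C \<in> Chains (relation_of (\<lambda>x y. y \<le> x) A)"
    then have C: "\<forall>q\<in>C. sublinear q \<and> q \<le> p" "\<forall>q\<in>C. \<forall>r\<in>C. q \<le> r \<or> r \<le> q"
      by (auto simp: Chains_def relation_of_def A_def)
    show "\<exists>u\<in>A. \<forall>a\<in>C. u \<le> a"
    proof (cases "C = {}")
      case True
      with p show ?thesis by (auto simp: A_def)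
    next
      case False
      note u = sublinear_INF_chain[OF False C]
      have "(\<lambda>x. INF q\<in>C. q x) \<le> q" if "q \<in> C" for q
        using u(2)[OF that] by (simp add: le_fun_def)
      with u(1) False C(1) show ?thesis
        by (intro bexI[of _ "\<lambda>x. INF q\<in>C. q x"]) (auto simp: A_def intro: order_trans)
    qed
  qed
  then show ?thesis
    by (auto simp: A_def intro: order_trans)
qed

text \<open>A minimal sublinear functional \<open>h\<close> below the directional modification of
  \<open>p\<close> at \<open>v\<close> is linear, and \<open>h (- v) \<le> - p v\<close> turns
  \<open>h v \<le> p v\<close> into an equality.\<close>

lemma Hahn_Banach_sublinear:
  assumes p: "sublinear p"
  shows "\<exists>h. linear h \<and> (\<forall>x. h x \<le> p x) \<and> h v = p v"
proof -
  let ?r = "\<lambda>x. INF t\<in>{0..}. p (x + t *\<^sub>R v) - t * p v"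
  note r = sublinear_directional[OF p, where y = v]
  obtain h where h: "sublinear h" "h \<le> ?r" "\<forall>r. sublinear r \<longrightarrow> r \<le> h \<longrightarrow> r = h"
    using ex_minimal_sublinear[OF r(1)] by blast
  have "linear h"
    using minimal_sublinear_linear h by blast
  moreover have le: "h x \<le> p x" for x
    using le_funD[OF h(2), of x] r(2)[of 0 x] by simp
  moreover have "h (- v) \<le> - p v"
    using le_funD[OF h(2), of "- v"] r(2)[of 1 "- v"] sublinear_zero[OF p] by simp
  ultimately show ?thesis
    using linear_neg[of h v] le[of v] by (intro exI[of _ h]) (auto intro: antisym)
qed

section \<open>Continuous selections\<close>

lemma geometric_tail_sum:
  fixes f :: "nat \<Rightarrow> 'b::banach"
  assumes bd: "\<And>k. norm (f k) \<le> (1/2) ^ k * G"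
  shows "summable f" and "norm (suminf f - sum f {..<n}) \<le> 2 * (1/2) ^ n * G"
proof -
  have sums: "(\<lambda>k. (1/2) ^ k * G) sums (2 * G)"
    using sums_mult2[OF geometric_sums[of "1/2 :: real"], of G] by simp
  show f: "summable f"
    by (rule summable_comparison_test[OF _ sums_summable[OF sums]]) (use bd in auto)
  have "(\<lambda>k. (1/2) ^ (k + n) * G) sums (2 * (1/2) ^ n * G)"
    using sums_mult[OF sums, of "(1/2) ^ n"] by (simp add: power_add mult_ac)
  moreover have "norm (f (k + n)) \<le> (1/2) ^ (k + n) * G" for k
    by (rule bd)
  ultimately have "norm (\<Sum>k. f (k + n)) \<le> 2 * (1/2) ^ n * G"
    by (metis norm_suminf_le sums_iff)
  then show "norm (suminf f - sum f {..<n}) \<le> 2 * (1/2) ^ n * G"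
    using suminf_split_initial_segment[OF f, of n] by simp
qed

lemma suminf_isCont:
  fixes f :: "nat \<Rightarrow> 'a::t2_space \<Rightarrow> 'b::banach"
  assumes bd: "\<And>k y. norm (f k y) \<le> (1/2) ^ k * G y"
    and cont: "\<And>k. isCont (f k) x" "isCont G x"
  shows "isCont (\<lambda>y. \<Sum>k. f k y) x"
proof (rule isCont_approx[where S = "\<lambda>n y. \<Sum>k<n. f k y" and r = "\<lambda>n y. 2 * (1/2) ^ n * G y"])
  show "isCont (\<lambda>y. \<Sum>k<n. f k y) x" "isCont (\<lambda>y. 2 * (1/2) ^ n * G y) x" for n
    by (intro continuous_intros cont)+
  have "(\<lambda>n. 2 * (1/2) ^ n * G x) \<longlonglongrightarrow> 2 * 0 * G x"
    by (intro tendsto_intros LIMSEQ_power_zero) simp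
  then show "(\<lambda>n. 2 * (1/2) ^ n * G x) \<longlonglongrightarrow> 0" by simp
  show "\<forall>\<^sub>F y in nhds x. norm ((\<Sum>k. f k y) - (\<Sum>k<n. f k y)) \<le> 2 * (1/2) ^ n * G y" for n
    by (intro always_eventually allI geometric_tail_sum(2) bd)
qed

lemma seminorm_isCont:
  fixes p :: "'a::real_normed_vector \<Rightarrow> real"
  assumes add: "\<And>x y. p (x + y) \<le> p x + p y"
    and scale: "\<And>c x. p (c *\<^sub>R x) = \<bar>c\<bar> * p x" and norm: "\<And>x. p x \<le> norm x"
  shows "isCont p x"
  unfolding isCont_def
proof (rule LIM_zero_cancel, rule Lim_null_comparison)
  have "p (x - y) = p (y - x)" for x y
    using scale[of "-1" "x - y"] by simp
  then have "norm (p y - p x) \<le> norm (y - x)" for y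
    using add[of "x - y" y] add[of "y - x" x] norm[of "x - y"] by (simp add: norm_minus_commute)
  then show "\<forall>\<^sub>F y in at x. norm (p y - p x) \<le> norm (y - x)"
    by simp
  have "isCont (\<lambda>y. norm (y - x)) x"
    by (intro continuous_intros)
  then show "((\<lambda>y. norm (y - x)) \<longlongrightarrow> 0) (at x)"
    by (simp add: isCont_def)
qed

text \<open>A partition-of-unity argument: \<open>w x\<close> is a weighted mean of those
  \<open>u k\<close> that are admissible for \<open>x\<close>, and both estimates survive averaging
  because seminorms are convex. Where \<open>p x = 0\<close>, the norm bound forces
  \<open>w x = 0\<close> and gives continuity.\<close>

lemma approximate_selection:
  fixes p :: "'a::banach \<Rightarrow> real" and u :: "nat \<Rightarrow> 'a"
  assumes p: "\<And>x y. p (x + y) \<le> p x + p y" "\<And>c x. p (c *\<^sub>R x) = \<bar>c\<bar> * p x" "\<And>x. p x \<le> norm x"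
    and pos: "\<And>x. 0 \<le> p x"
    and approx: "\<And>x. 0 < p x \<Longrightarrow> \<exists>k. p (x - u k) < p x / 2 \<and> norm (u k) < C * p x"
    and K: "subspace K" "closed K" "range u \<subseteq> K" and "0 \<le> C"
  shows "\<exists>w. (\<forall>x. isCont w x) \<and> (\<forall>x. p (x - w x) \<le> p x / 2) \<and> range w \<subseteq> K \<and>
    (\<forall>x. norm (w x) \<le> C * p x)"
proof -
  \<comment> \<open>The weight is positive exactly if \<open>u k\<close> satisfies both inequalities
    strictly. The caps at 1 and the factor \<open>(1/2) ^ k\<close> make the sums converge to
    continuous limits.\<close>
  define \<alpha> where "\<alpha> k x = (1/2) ^ k * (min 1 (max 0 (p x / 2 - p (x - u k))) *
    min 1 (max 0 (C * p x - norm (u k))))" for k x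
  have \<alpha>: "0 \<le> \<alpha> k x" "\<alpha> k x \<le> (1/2) ^ k" for k x
  proof -
    have "0 \<le> min 1 (max 0 s) * min 1 (max 0 t)" "min 1 (max 0 s) * min 1 (max 0 t) \<le> 1" for s t :: real
      by (auto intro!: mult_le_one)
    then show "0 \<le> \<alpha> k x" "\<alpha> k x \<le> (1/2) ^ k"
      by (auto simp: \<alpha>_def intro!: mult_left_le)
  qed
  have \<alpha>_zero: "\<alpha> k x = 0 \<or> p (x - u k) \<le> p x / 2 \<and> norm (u k) \<le> C * p x" for k x
    by (auto simp: \<alpha>_def max_def)
  define S where "S x = (\<Sum>k. \<alpha> k x)" for x
  define V where "V x = (\<Sum>k. \<alpha> k x *\<^sub>R u k)" for x
  have V_bd: "norm (\<alpha> k x *\<^sub>R u k) \<le> \<alpha> k x * (C * p x)" for k x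
    using \<alpha>_zero[of k x] \<alpha>(1)[of k x] by (auto intro: mult_left_mono)
  then have V_bd': "norm (\<alpha> k x *\<^sub>R u k) \<le> (1/2) ^ k * (C * p x)" for k x
    using \<open>0 \<le> C\<close> pos by (blast intro: order_trans mult_right_mono \<alpha> mult_nonneg_nonneg)
  have S_bd: "norm (\<alpha> k x) \<le> (1/2) ^ k * 1" for k x
    using \<alpha>[of k x] by simp
  have S_sums: "(\<lambda>k. \<alpha> k x) sums S x" and V_sums: "(\<lambda>k. \<alpha> k x *\<^sub>R u k) sums V x" for x
    unfolding S_def V_def
    by (rule summable_sums, rule geometric_tail_sum, rule S_bd)
      (rule summable_sums, rule geometric_tail_sum, rule V_bd')
  note cont_p = seminorm_isCont[of p, OF p]
  have cont_p': "isCont (\<lambda>x. p (x - a)) y" for a y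
    by (rule isCont_o2[OF _ cont_p]) (intro continuous_intros)
  have cont_\<alpha>: "isCont (\<alpha> k) x" for k x
    unfolding \<alpha>_def by (intro continuous_intros cont_p cont_p') simp
  have cont_S: "isCont S x" for x
    unfolding S_def by (rule suminf_isCont[OF S_bd cont_\<alpha>]) simp
  have cont_V: "isCont V x" for x
    unfolding V_def by (rule suminf_isCont[OF V_bd']) (intro continuous_intros cont_\<alpha> cont_p)+
  have S_pos: "0 < S x" if px: "0 < p x" for x
  proof -
    obtain k where "p (x - u k) < p x / 2" "norm (u k) < C * p x"
      using approx[OF px] by blast
    then have "0 < \<alpha> k x"
      by (auto simp: \<alpha>_def)
    then show ?thesis
      using S_sums[of x] \<alpha>(1) unfolding S_def
      by (intro suminf_pos2[of _ k]) (auto simp: sums_iff)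
  qed
  have S_nonneg: "0 \<le> S x" for x
    unfolding S_def using S_sums[of x] \<alpha>(1) by (intro suminf_nonneg) (auto simp: sums_iff)
  have V_norm: "norm (V x) \<le> S x * (C * p x)" for x
  proof -
    note sums = sums_mult2[OF S_sums[of x], of "C * p x"]
    have "norm (V x) \<le> (\<Sum>k. \<alpha> k x * (C * p x))"
      unfolding V_def by (rule norm_suminf_le[OF V_bd sums_summable[OF sums]])
    with sums_unique[OF sums] show ?thesis by simp
  qed
  have V_p: "p (S x *\<^sub>R x - V x) \<le> S x * (p x / 2)" for x
  proof (rule LIMSEQ_le)
    have "(\<lambda>k. \<alpha> k x *\<^sub>R (x - u k)) sums (S x *\<^sub>R x - V x)"
      using sums_diff[OF bounded_linear.sums[OF bounded_linear_scaleR_left S_sums[of x], of x] V_sums[of x]]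
      by (simp add: scaleR_diff_right)
    then show "(\<lambda>n. p (\<Sum>k<n. \<alpha> k x *\<^sub>R (x - u k))) \<longlonglongrightarrow> p (S x *\<^sub>R x - V x)"
      unfolding sums_def by (rule isCont_tendsto_compose[OF cont_p])
    show "(\<lambda>n. \<Sum>k<n. \<alpha> k x * (p x / 2)) \<longlonglongrightarrow> S x * (p x / 2)"
      using sums_mult2[OF S_sums[of x]] unfolding sums_def .
    have "p (\<Sum>k<n. \<alpha> k x *\<^sub>R (x - u k)) \<le> (\<Sum>k<n. \<alpha> k x * (p x / 2))" for n
    proof (induction n)
      case 0
      then show ?case using p(2)[of 0 0] by simp
    next
      case (Suc n)
      have "p (\<alpha> n x *\<^sub>R (x - u n)) \<le> \<alpha> n x * (p x / 2)"
        unfolding p(2) using \<alpha>_zero[of n x] \<alpha>(1)[of n x]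
          mult_left_mono[OF _ \<alpha>(1)[of n x], of "p (x - u n)" "p x / 2"] by auto
      then show ?case
        using Suc p(1)[of "\<Sum>k<n. \<alpha> k x *\<^sub>R (x - u k)" "\<alpha> n x *\<^sub>R (x - u n)"] by simp
    qed
    then show "\<exists>N. \<forall>n\<ge>N. p (\<Sum>k<n. \<alpha> k x *\<^sub>R (x - u k)) \<le> (\<Sum>k<n. \<alpha> k x * (p x / 2))"
      by blast
  qed
  have V_K: "V x \<in> K" for x
  proof (rule closed_sequentially[OF K(2)])
    show "(\<Sum>k<n. \<alpha> k x *\<^sub>R u k) \<in> K" for n
      using K by (intro subspace_sum subspace_scale) auto
    show "(\<lambda>n. \<Sum>k<n. \<alpha> k x *\<^sub>R u k) \<longlonglongrightarrow> V x"
      using V_sums[of x] by (simp add: sums_def)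
  qed
  \<comment> \<open>If \<open>S x = 0\<close>, then \<open>inverse 0 = 0\<close> gives
    \<open>w x = 0\<close>; by \<open>S_pos\<close> this happens only where
    \<open>p x = 0\<close>.\<close>
  define w where "w x = inverse (S x) *\<^sub>R V x" for x
  have cancel: "inverse s * (s * r) = r" if "s \<noteq> 0" for s r :: real
    using that by simp
  have w_norm: "norm (w x) \<le> C * p x" for x
  proof (cases "S x = 0")
    case False
    then have "norm (w x) \<le> inverse (S x) * (S x * (C * p x))"
      unfolding w_def norm_scaleR using S_nonneg[of x] V_norm[of x] by (intro mult_mono) auto
    then show ?thesis by (simp only: cancel[OF False])
  qed (use pos \<open>0 \<le> C\<close> in \<open>simp add: w_def\<close>)
  have "isCont w x" for x
  proof (cases "p x = 0")
    case True
    with w_norm[of x] have "w x = 0" by simp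
    moreover have "(w \<longlongrightarrow> 0) (at x)"
    proof (rule Lim_null_comparison)
      show "\<forall>\<^sub>F y in at x. norm (w y) \<le> C * p y"
        using w_norm by simp
      have "isCont (\<lambda>y. C * p y) x"
        by (intro continuous_intros cont_p)
      then show "((\<lambda>y. C * p y) \<longlongrightarrow> 0) (at x)"
        using True by (simp add: isCont_def)
    qed
    ultimately show ?thesis by (simp add: isCont_def)
  next
    case False
    then have "S x \<noteq> 0"
      using S_pos[of x] pos[of x] by force
    then show ?thesis
      unfolding w_def by (intro continuous_intros cont_S cont_V) auto
  qed
  moreover have "p (x - w x) \<le> p x / 2" for x
  proof (cases "p x = 0")
    case True
    with w_norm[of x] show ?thesis by simp
  next
    case False
    then have S: "0 < S x"
      using S_pos[of x] pos[of x] by force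
    then have "x - w x = inverse (S x) *\<^sub>R (S x *\<^sub>R x - V x)"
      by (simp add: w_def scaleR_diff_right)
    then have "p (x - w x) = inverse (S x) * p (S x *\<^sub>R x - V x)"
      using S by (simp only: p(2)) simp
    also have "\<dots> \<le> inverse (S x) * (S x * (p x / 2))"
      using S V_p[of x] by (intro mult_left_mono) auto
    finally show ?thesis
      by (simp only: cancel[OF not_sym[OF less_imp_neq[OF S]]])
  qed
  moreover have "range w \<subseteq> K"
    unfolding w_def using V_K K by (auto intro: subspace_scale)
  ultimately show ?thesis
    using w_norm by blast
qed

text \<open>As in the Bartle-Graves theorem, the approximate selection is iterated on the remainders
  \<open>x - w x\<close>, which shrink geometrically.\<close>

lemma exact_selection:
  fixes p :: "'a::banach \<Rightarrow> real" and u :: "nat \<Rightarrow> 'a"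
  assumes p: "\<And>x y. p (x + y) \<le> p x + p y" "\<And>c x. p (c *\<^sub>R x) = \<bar>c\<bar> * p x" "\<And>x. p x \<le> norm x"
    and pos: "\<And>x. 0 \<le> p x"
    and approx: "\<And>x. 0 < p x \<Longrightarrow> \<exists>k. p (x - u k) < p x / 2 \<and> norm (u k) < C * p x"
    and K: "subspace K" "closed K" "range u \<subseteq> K" and "0 \<le> C"
  shows "\<exists>w. (\<forall>x. isCont w x) \<and> (\<forall>x. p (w x - x) = 0) \<and> range w \<subseteq> K \<and>
    (\<forall>x. norm (w x) \<le> 2 * C * p x)"
proof -
  obtain w\<^sub>0 where w0: "\<And>x. isCont w\<^sub>0 x" "\<And>x. p (x - w\<^sub>0 x) \<le> p x / 2" "range w\<^sub>0 \<subseteq> K"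
    "\<And>x. norm (w\<^sub>0 x) \<le> C * p x"
    using approximate_selection[of p u C K] assms by (metis (no_types, lifting))
  define t where "t k x = ((\<lambda>x. x - w\<^sub>0 x) ^^ k) x" for k x
  have t: "t 0 x = x" "t (Suc k) x = t k x - w\<^sub>0 (t k x)" for k x
    by (simp_all add: t_def)
  have p_t: "p (t k x) \<le> (1/2) ^ k * p x" for k x
  proof (induction k)
    case (Suc k)
    then show ?case using w0(2)[of "t k x"] by (simp add: t)
  qed (simp add: t)
  have cont_t: "isCont (t k) x" for k x
  proof (induction k)
    case 0
    then show ?case by (simp add: t(1)[abs_def])
  next
    case (Suc k)
    then show ?case
      unfolding t(2)[abs_def] by (intro continuous_intros isCont_o2[OF _ w0(1)])
  qed
  define w where "w x = (\<Sum>k. w\<^sub>0 (t k x))" for x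
  have bd: "norm (w\<^sub>0 (t k x)) \<le> (1/2) ^ k * (C * p x)" for k x
    using w0(4)[of "t k x"] mult_left_mono[OF p_t[of k x] \<open>0 \<le> C\<close>] by (simp add: mult_ac)
  have sums: "(\<lambda>k. w\<^sub>0 (t k x)) sums w x" for x
    unfolding w_def by (rule summable_sums, rule geometric_tail_sum, rule bd)
  note cont_p = seminorm_isCont[of p, OF p]
  have "isCont w x" for x
    unfolding w_def
    by (rule suminf_isCont[OF bd]) (intro isCont_o2[OF cont_t w0(1)] continuous_intros cont_p)+
  moreover have "norm (w x) \<le> 2 * C * p x" for x
    using geometric_tail_sum(2)[of "\<lambda>k. w\<^sub>0 (t k x)", OF bd, of 0] by (simp add: w_def mult_ac)
  moreover have "p (w x - x) = 0" for x
  proof -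
    have tel: "(\<Sum>k<n. w\<^sub>0 (t k x)) - x = - t n x" for n
      by (induction n) (simp_all add: t algebra_simps)
    have "(\<lambda>n. p ((\<Sum>k<n. w\<^sub>0 (t k x)) - x)) \<longlonglongrightarrow> p (w x - x)"
      by (rule isCont_tendsto_compose[OF cont_p]) (intro tendsto_intros sums[unfolded sums_def])
    moreover have "(\<lambda>n. p ((\<Sum>k<n. w\<^sub>0 (t k x)) - x)) \<longlonglongrightarrow> 0"
    proof (rule Lim_null_comparison)
      have "p (- t n x) \<le> (1/2) ^ n * p x" for n
        using p(2)[of "-1" "t n x"] p_t[of n x] by simp
      then show "\<forall>\<^sub>F n in sequentially. norm (p ((\<Sum>k<n. w\<^sub>0 (t k x)) - x)) \<le> (1/2) ^ n * p x"
        by (simp add: tel pos)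
      have "(\<lambda>n. (1/2) ^ n * p x) \<longlonglongrightarrow> 0 * p x"
        by (intro tendsto_intros LIMSEQ_power_zero) simp
      then show "(\<lambda>n. (1/2) ^ n * p x) \<longlonglongrightarrow> 0" by simp
    qed
    ultimately show ?thesis
      by (rule LIMSEQ_unique)
  qed
  moreover have "w x \<in> K" for x
  proof (rule closed_sequentially[OF K(2)])
    show "(\<Sum>k<n. w\<^sub>0 (t k x)) \<in> K" for n
      using K w0(3) by (intro subspace_sum) auto
    show "(\<lambda>n. \<Sum>k<n. w\<^sub>0 (t k x)) \<longlonglongrightarrow> w x"
      using sums[of x] by (simp add: sums_def)
  qed
  ultimately show ?thesis by blast
qed

section \<open>Lifting functionals to a dense chain of subspaces\<close>

text \<open>Induction on \<open>N\<close>. Either the common kernel of the earlier functionals in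
  some \<open>E m\<close> contains \<open>k\<close> with \<open>G N k = 1\<close>, and a multiple of
  \<open>k\<close> corrects the value of \<open>G N\<close>; or \<open>G N\<close> vanishes on the
  common kernel in the whole space, and the earlier lift works unchanged.\<close>

lemma common_kernel_lift:
  fixes E :: "nat \<Rightarrow> 'a::real_normed_vector set" and G :: "nat \<Rightarrow> 'a \<Rightarrow> real"
  assumes sub: "\<And>n. subspace (E n)" and mono: "\<And>m n. m \<le> n \<Longrightarrow> E m \<subseteq> E n"
    and dense: "\<And>x e. 0 < e \<Longrightarrow> \<exists>n. \<exists>y\<in>E n. norm (x - y) < e"
    and lin: "\<And>i. linear (G i)" and bd: "\<And>i x. \<bar>G i x\<bar> \<le> norm x"
  shows "\<exists>n L. 0 \<le> L \<and> (\<forall>x. \<exists>z\<in>E n. (\<forall>i<N. G i z = G i x) \<and> norm z \<le> L * (\<Sum>i<N. \<bar>G i x\<bar>))"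
proof (induction N)
  case 0
  show ?case
    using subspace_0[OF sub] by (intro exI[of _ 0]) auto
next
  case (Suc N)
  then obtain n L where L: "0 \<le> L" and lift: "\<And>x. \<exists>z\<in>E n. (\<forall>i<N. G i z = G i x) \<and> norm z \<le> L * (\<Sum>i<N. \<bar>G i x\<bar>)"
    by blast
  note G_simps = linear_add[OF lin] linear_diff[OF lin] linear_scale[OF lin]
  show ?case
  proof (cases "\<exists>m. \<exists>k\<in>E m. (\<forall>i<N. G i k = 0) \<and> G N k \<noteq> 0")
    case True
    then obtain m k\<^sub>0 where k0: "k\<^sub>0 \<in> E m" "\<forall>i<N. G i k\<^sub>0 = 0" "G N k\<^sub>0 \<noteq> 0" by blast
    define k where "k = inverse (G N k\<^sub>0) *\<^sub>R k\<^sub>0"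
    have k: "k \<in> E m" "\<And>i. i < N \<Longrightarrow> G i k = 0" "G N k = 1"
      using k0 sub by (auto simp: k_def G_simps subspace_scale)
    have "\<exists>z\<in>E (max n m). (\<forall>i<Suc N. G i z = G i x) \<and>
        norm z \<le> (L + (1 + L) * norm k) * (\<Sum>i<Suc N. \<bar>G i x\<bar>)" for x
    proof -
      let ?s = "\<Sum>i<N. \<bar>G i x\<bar>"
      obtain z where z: "z \<in> E n" "\<forall>i<N. G i z = G i x" "norm z \<le> L * ?s"
        using lift by blast
      let ?z = "z + (G N x - G N z) *\<^sub>R k"
      have s: "0 \<le> ?s" by (simp add: sum_nonneg)
      have "\<bar>G N x - G N z\<bar> \<le> \<bar>G N x\<bar> + L * ?s"
        using bd[of N z] z(3) by linarith
      also have "\<dots> \<le> (1 + L) * (?s + \<bar>G N x\<bar>)"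
        using L s by (simp add: algebra_simps)
      finally have "norm ?z \<le> L * ?s + (1 + L) * (?s + \<bar>G N x\<bar>) * norm k"
        using z(3) by (intro norm_triangle_le add_mono) (auto intro: mult_right_mono)
      also have "\<dots> \<le> (L + (1 + L) * norm k) * (\<Sum>i<Suc N. \<bar>G i x\<bar>)"
        using L by (simp add: algebra_simps)
      finally have "norm ?z \<le> (L + (1 + L) * norm k) * (\<Sum>i<Suc N. \<bar>G i x\<bar>)" .
      moreover have "?z \<in> E (max n m)"
        using z(1) k(1) mono[of n "max n m"] mono[of m "max n m"]
        by (intro subspace_add subspace_scale sub) auto
      moreover have "\<forall>i<Suc N. G i ?z = G i x"
        using z(2) k by (auto simp: G_simps less_Suc_eq)
      ultimately show ?thesis by blast
    qed
    then show ?thesis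
      using L by (intro exI[of _ "max n m"] exI[of _ "L + (1 + L) * norm k"]) auto
  next
    case False
    \<comment> \<open>\<open>y\<close> is approximated by \<open>y'\<close> in some
      \<open>E m\<close>, and subtracting a small lift \<open>z\<close> moves \<open>y'\<close> into
      the kernel, where \<open>G N\<close> vanishes by the case assumption. So \<open>G N y\<close>
      is of the order of the error \<open>e\<close>.\<close>
    have zero: "G N y = 0" if y: "\<And>i. i < N \<Longrightarrow> G i y = 0" for y
    proof -
      have "\<bar>G N y\<bar> \<le> (1 + L * N) * e" if e: "0 < e" for e
      proof -
        obtain m y' where y': "y' \<in> E m" "norm (y - y') < e"
          using dense[OF e] by blast
        obtain z where z: "z \<in> E n" "\<forall>i<N. G i z = G i y'" "norm z \<le> L * (\<Sum>i<N. \<bar>G i y'\<bar>)"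
          using lift by blast
        have "\<bar>G i y'\<bar> \<le> e" if "i < N" for i
          using bd[of i "y - y'"] y'(2) y[OF that] by (simp add: G_simps)
        then have sum: "L * (\<Sum>i<N. \<bar>G i y'\<bar>) \<le> L * (N * e)"
          using L sum_bounded_above[of "{..<N}" "\<lambda>i. \<bar>G i y'\<bar>" e] by (intro mult_left_mono) auto
        have "y' - z \<in> E (max m n)"
          using y'(1) z(1) mono[of n "max m n"] mono[of m "max m n"]
          by (intro subspace_diff sub) auto
        moreover have "\<forall>i<N. G i (y' - z) = 0"
          using z(2) by (simp add: G_simps)
        ultimately have "G N (y' - z) = 0"
          using False by blast
        then have "G N y = G N (y - y') + G N z"
          by (simp add: G_simps)
        then show ?thesis
          using sum bd[of N "y - y'"] bd[of N z] y'(2) z(3) by (simp add: algebra_simps)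
      qed
      then have "\<bar>G N y\<bar> \<le> (1 + L * N) * 0"
        by (intro tendsto_lowerbound[where f = "\<lambda>e. (1 + L * N) * e" and F = "at_right 0"] tendsto_intros)
          (auto simp: eventually_at_right_less eventually_mono[OF eventually_at_right_less])
      then show ?thesis by simp
    qed
    have "\<exists>z\<in>E n. (\<forall>i<Suc N. G i z = G i x) \<and> norm z \<le> L * (\<Sum>i<Suc N. \<bar>G i x\<bar>)" for x
    proof -
      obtain z where z: "z \<in> E n" "\<forall>i<N. G i z = G i x" "norm z \<le> L * (\<Sum>i<N. \<bar>G i x\<bar>)"
        using lift by blast
      have "G N (x - z) = 0"
        by (rule zero) (use z(2) in \<open>simp add: G_simps\<close>)
      then have "\<forall>i<Suc N. G i z = G i x"
        using z(2) by (auto simp: G_simps less_Suc_eq)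
      moreover have "L * (\<Sum>i<N. \<bar>G i x\<bar>) \<le> L * (\<Sum>i<Suc N. \<bar>G i x\<bar>)"
        using L by (intro mult_left_mono) auto
      ultimately have "norm z \<le> L * (\<Sum>i<Suc N. \<bar>G i x\<bar>)"
        using z(3) by (meson order_trans)
      with z(1) \<open>\<forall>i<Suc N. G i z = G i x\<close> show ?thesis
        by blast
    qed
    with L show ?thesis by blast
  qed
qed

text \<open>The first \<open>N\<close> functionals map the unit ball to a bounded set, which meets
  finitely many cells of a grid of width \<open>\<eta>\<close>; \<open>\<kappa>\<close> gives the
  cell, and \<open>A\<close> represents every cell that is met.\<close>

lemma finite_functional_net:
  fixes G :: "nat \<Rightarrow> 'a::real_normed_vector \<Rightarrow> real"
  assumes bd: "\<And>i x. \<bar>G i x\<bar> \<le> norm x" and "0 < \<eta>"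
  shows "\<exists>A. finite A \<and> A \<subseteq> cball 0 1 \<and> (\<forall>x\<in>cball 0 1. \<exists>a\<in>A. \<forall>i<N. \<bar>G i x - G i a\<bar> \<le> \<eta>)"
proof -
  define \<kappa> where "\<kappa> x = restrict (\<lambda>i. \<lfloor>G i x / \<eta>\<rfloor>) {..<N}" for x
  have "\<kappa> ` cball 0 1 \<subseteq> PiE {..<N} (\<lambda>_. {\<lfloor>- 1 / \<eta>\<rfloor>..\<lfloor>1 / \<eta>\<rfloor>})"
  proof
    fix k assume "k \<in> \<kappa> ` cball 0 1"
    then obtain x where x: "norm x \<le> 1" "k = \<kappa> x" by auto
    have "- 1 / \<eta> \<le> G i x / \<eta>" "G i x / \<eta> \<le> 1 / \<eta>" for i
      using bd[of i x] x(1) \<open>0 < \<eta>\<close> by (intro divide_right_mono; linarith)+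
    then show "k \<in> PiE {..<N} (\<lambda>_. {\<lfloor>- 1 / \<eta>\<rfloor>..\<lfloor>1 / \<eta>\<rfloor>})"
      unfolding x(2) \<kappa>_def by (auto intro!: floor_mono)
  qed
  then have "finite (\<kappa> ` cball 0 1)"
    by (rule finite_subset) (auto intro: finite_PiE)
  then obtain A where A: "A \<subseteq> cball 0 1" "finite A" "\<kappa> ` cball 0 1 = \<kappa> ` A"
    using finite_subset_image[of "\<kappa> ` cball 0 1" \<kappa> "cball 0 1"] by blast
  have "\<exists>a\<in>A. \<forall>i<N. \<bar>G i x - G i a\<bar> \<le> \<eta>" if "x \<in> cball 0 1" for x
  proof -
    obtain a where a: "a \<in> A" "\<kappa> x = \<kappa> a"
      using A(3) \<open>x \<in> cball 0 1\<close> by (metis imageE imageI)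
    have "\<bar>G i x - G i a\<bar> \<le> \<eta>" if "i < N" for i
    proof -
      have "\<lfloor>G i x / \<eta>\<rfloor> = \<lfloor>G i a / \<eta>\<rfloor>"
        using fun_cong[OF a(2), of i] that by (simp add: \<kappa>_def)
      then have "\<bar>G i x / \<eta> - G i a / \<eta>\<bar> \<le> 1"
        by linarith
      then have "\<bar>G i x - G i a\<bar> / \<eta> \<le> 1"
        using \<open>0 < \<eta>\<close> by (simp add: abs_divide flip: diff_divide_distrib)
      then show ?thesis
        using \<open>0 < \<eta>\<close> by (simp add: divide_le_eq)
    qed
    with a(1) show ?thesis by blast
  qed
  with A show ?thesis by blast
qed

text \<open>The constant 3 does not depend on the functionals: a point of the unit ball is approximated by
  a finite net, which already lies in some \<open>E n\<close>, and only the small error is lifted by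
  \<open>common_kernel_lift\<close>, whose constant is uncontrolled.\<close>

lemma bounded_functional_lift:
  fixes E :: "nat \<Rightarrow> 'a::real_normed_vector set" and G :: "nat \<Rightarrow> 'a \<Rightarrow> real"
  assumes sub: "\<And>n. subspace (E n)" and mono: "\<And>m n. m \<le> n \<Longrightarrow> E m \<subseteq> E n"
    and dense: "\<And>x e. 0 < e \<Longrightarrow> \<exists>n. \<exists>y\<in>E n. norm (x - y) < e"
    and lin: "\<And>i. linear (G i)" and bd: "\<And>i x. \<bar>G i x\<bar> \<le> norm x"
  shows "\<exists>n. \<forall>x. \<exists>z\<in>E n. (\<forall>i<N. G i z = G i x) \<and> norm z \<le> 3 * norm x"
proof -
  note G_simps = linear_add[OF lin] linear_diff[OF lin] linear_scale[OF lin]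
  obtain n L where L: "0 \<le> L" and lift: "\<And>x. \<exists>z\<in>E n. (\<forall>i<N. G i z = G i x) \<and> norm z \<le> L * (\<Sum>i<N. \<bar>G i x\<bar>)"
    using common_kernel_lift[of E G N, OF sub mono dense lin bd] by blast
  \<comment> \<open>Chosen so that the lift of an error with values at most
    \<open>2 * \<eta>\<close> has norm at most 1. The net points, moved into the chain, have norm at
    most 2, whence the constant 3.\<close>
  define \<eta> where "\<eta> = 1 / (1 + 2 * L * N)"
  have "0 \<le> 2 * L * N" using L by simp
  then have \<eta>: "0 < \<eta>" "\<eta> \<le> 1" "L * (N * (2 * \<eta>)) \<le> 1"
    by (auto simp: \<eta>_def field_simps)
  obtain A where A: "finite A" "A \<subseteq> cball 0 1" "\<And>x. norm x \<le> 1 \<Longrightarrow> \<exists>a\<in>A. \<forall>i<N. \<bar>G i x - G i a\<bar> \<le> \<eta>"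
    using finite_functional_net[of G \<eta> N, OF bd \<eta>(1)] by auto
  obtain m r where r: "\<And>a. r a \<in> E (m a)" "\<And>a. norm (a - r a) < \<eta>"
    using dense[OF \<eta>(1)] by metis
  define K where "K = Max (insert n (m ` A))"
  have K: "n \<le> K" "\<And>a. a \<in> A \<Longrightarrow> m a \<le> K"
    using A(1) by (auto simp: K_def)
  have unit: "\<exists>z\<in>E K. (\<forall>i<N. G i z = G i x) \<and> norm z \<le> 3" if x: "norm x \<le> 1" for x
  proof -
    obtain a where a: "a \<in> A" "\<And>i. i < N \<Longrightarrow> \<bar>G i x - G i a\<bar> \<le> \<eta>"
      using A(3)[OF x] by blast
    obtain z where z: "z \<in> E n" "\<forall>i<N. G i z = G i (x - r a)" "norm z \<le> L * (\<Sum>i<N. \<bar>G i (x - r a)\<bar>)"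
      using lift by blast
    have "\<bar>G i (x - r a)\<bar> \<le> 2 * \<eta>" if "i < N" for i
      using a(2)[OF that] bd[of i "a - r a"] r(2)[of a] by (simp add: G_simps)
    then have "L * (\<Sum>i<N. \<bar>G i (x - r a)\<bar>) \<le> L * (N * (2 * \<eta>))"
      using L sum_bounded_above[of "{..<N}" "\<lambda>i. \<bar>G i (x - r a)\<bar>" "2 * \<eta>"]
      by (intro mult_left_mono) auto
    then have "norm z \<le> 1"
      using z(3) \<eta>(3) by linarith
    moreover have "norm (r a) \<le> 2"
      using r(2)[of a] \<eta>(2) A(2) a(1) norm_triangle_ineq4[of a "a - r a"] by (auto simp: subset_iff)
    ultimately have "norm (r a + z) \<le> 3"
      using norm_triangle_ineq[of "r a" z] by linarith
    moreover have "r a + z \<in> E K"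
      using r(1)[of a] z(1) mono[OF K(1)] mono[OF K(2)[OF a(1)]] by (intro subspace_add sub) auto
    moreover have "\<forall>i<N. G i (r a + z) = G i x"
      using z(2) by (auto simp: G_simps)
    ultimately show ?thesis by blast
  qed
  have "\<exists>z\<in>E K. (\<forall>i<N. G i z = G i x) \<and> norm z \<le> 3 * norm x" for x
  proof (cases "x = 0")
    case True
    then show ?thesis
      using subspace_0[OF sub] by (intro bexI[of _ 0]) auto
  next
    case False
    obtain z where z: "z \<in> E K" "\<forall>i<N. G i z = G i (inverse (norm x) *\<^sub>R x)" "norm z \<le> 3"
      using unit[of "inverse (norm x) *\<^sub>R x"] False by auto
    then show ?thesis
      using False sub by (intro bexI[of _ "norm x *\<^sub>R z"]) (auto simp: G_simps subspace_scale)
  qed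
  then show ?thesis by blast
qed

section \<open>Distances to subspaces, extension by one vector, and a Baire argument\<close>

lemma infdist_near:
  assumes "A \<noteq> {}" "infdist x A < r"
  shows "\<exists>a\<in>A. dist x a < r"
  using assms cInf_lessD[of "dist x ` A" r] by (auto simp: infdist_notempty)

lemma infdist_subspace_add:
  fixes E :: "'a::real_normed_vector set"
  assumes "subspace E"
  shows "infdist (x + y) E \<le> infdist x E + infdist y E"
proof (rule field_le_epsilon)
  fix e :: real assume "0 < e"
  have ne: "E \<noteq> {}" using subspace_0[OF assms] by auto
  obtain a where a: "a \<in> E" "dist x a < infdist x E + e / 2"
    using infdist_near[OF ne, of x "infdist x E + e / 2"] \<open>0 < e\<close> by auto
  obtain b where b: "b \<in> E" "dist y b < infdist y E + e / 2"
    using infdist_near[OF ne, of y "infdist y E + e / 2"] \<open>0 < e\<close> by auto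
  have "infdist (x + y) E \<le> dist (x + y) (a + b)"
    using a b by (intro infdist_le subspace_add[OF assms])
  also have "\<dots> \<le> dist x a + dist y b"
    by (rule dist_triangle_add)
  finally show "infdist (x + y) E \<le> infdist x E + infdist y E + e"
    using a b by linarith
qed

lemma infdist_subspace_scale:
  fixes E :: "'a::real_normed_vector set"
  assumes "subspace E"
  shows "infdist (c *\<^sub>R x) E = \<bar>c\<bar> * infdist x E"
proof -
  have ne: "E \<noteq> {}" using subspace_0[OF assms] by auto
  have le: "infdist (c *\<^sub>R x) E \<le> \<bar>c\<bar> * infdist x E" if "c \<noteq> 0" for c x
  proof -
    have "infdist (c *\<^sub>R x) E / \<bar>c\<bar> \<le> infdist x E"
      unfolding infdist_notempty[OF ne, of x]
    proof (rule cINF_greatest[OF ne])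
      fix a assume "a \<in> E"
      then have "infdist (c *\<^sub>R x) E \<le> dist (c *\<^sub>R x) (c *\<^sub>R a)"
        by (intro infdist_le subspace_scale[OF assms])
      also have "\<dots> = \<bar>c\<bar> * dist x a"
        by (simp add: dist_norm flip: scaleR_diff_right)
      finally show "infdist (c *\<^sub>R x) E / \<bar>c\<bar> \<le> dist x a"
        using that by (simp add: divide_le_eq mult.commute)
    qed
    then show ?thesis
      using that by (simp add: divide_le_eq mult.commute)
  qed
  show ?thesis
  proof (cases "c = 0")
    case True
    then show ?thesis
      using subspace_0[OF assms] by simp
  next
    case False
    then have "\<bar>c\<bar> * infdist x E \<le> infdist (c *\<^sub>R x) E"
      using le[of "inverse c" "c *\<^sub>R x"] by (simp add: field_simps)
    with le[OF False] show ?thesis by (rule antisym)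
  qed
qed

lemma infdist_subspace_le_norm:
  fixes E :: "'a::real_normed_vector set"
  assumes "subspace E"
  shows "infdist x E \<le> norm x"
  using infdist_le[OF subspace_0[OF assms], of x] by simp

text \<open>\<open>E'\<close> is the sum of \<open>E\<close> and the line through \<open>d\<close>.
  If \<open>d\<close> is not in \<open>E\<close>, the coefficient of \<open>d\<close> is a Lipschitz
  function of the point, so the coefficients along a convergent sequence converge.\<close>

lemma closed_subspace_insert:
  fixes E :: "'a::real_normed_vector set" and d :: 'a
  assumes E: "subspace E" "closed E"
  defines "E' \<equiv> {x. \<exists>c. x - c *\<^sub>R d \<in> E}"
  shows "subspace E'" "closed E'" "E \<subseteq> E'" "d \<in> E'"
proof -
  show "subspace E'"
    unfolding subspace_def E'_def
  proof (intro conjI ballI allI CollectI)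
    show "\<exists>c. 0 - c *\<^sub>R d \<in> E"
      using subspace_0[OF E(1)] by (intro exI[of _ 0]) simp
  next
    fix x y assume "x \<in> {x. \<exists>c. x - c *\<^sub>R d \<in> E}" "y \<in> {x. \<exists>c. x - c *\<^sub>R d \<in> E}"
    then obtain b c where "x - b *\<^sub>R d \<in> E" "y - c *\<^sub>R d \<in> E" by blast
    then have "(x + y) - (b + c) *\<^sub>R d \<in> E"
      using subspace_add[OF E(1)] by (fastforce simp: algebra_simps)
    then show "\<exists>c. x + y - c *\<^sub>R d \<in> E" by blast
  next
    fix r x assume "x \<in> {x. \<exists>c. x - c *\<^sub>R d \<in> E}"
    then obtain c where "x - c *\<^sub>R d \<in> E" by blast
    then have "r *\<^sub>R x - (r * c) *\<^sub>R d \<in> E"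
      using subspace_scale[OF E(1), of "x - c *\<^sub>R d" r] by (simp add: scaleR_diff_right)
    then show "\<exists>c. r *\<^sub>R x - c *\<^sub>R d \<in> E" by blast
  qed
  show "E \<subseteq> E'"
    unfolding E'_def by (auto intro: exI[of _ 0])
  show "d \<in> E'"
    unfolding E'_def using subspace_0[OF E(1)] by (auto intro: exI[of _ 1])
  have ne: "E \<noteq> {}" using subspace_0[OF E(1)] by auto
  show "closed E'"
  proof (cases "d \<in> E")
    case True
    then have "x - c *\<^sub>R d \<in> E \<longleftrightarrow> x \<in> E" for x c
      using subspace_add[OF E(1), of "x - c *\<^sub>R d" "c *\<^sub>R d"] subspace_diff[OF E(1), of x "c *\<^sub>R d"]
        subspace_scale[OF E(1)] by auto
    then show ?thesis using E(2) by (simp add: E'_def)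
  next
    case False
    define \<delta> where "\<delta> = infdist d E"
    have "0 < \<delta>"
      using False infdist_pos_not_in_closed[OF E(2) ne] by (simp add: \<delta>_def)
    have coeff: "\<bar>b - c\<bar> * \<delta> \<le> norm (x - y)" if "x - b *\<^sub>R d \<in> E" "y - c *\<^sub>R d \<in> E" for x y b c
    proof -
      have "infdist ((b - c) *\<^sub>R d) E \<le> norm ((b - c) *\<^sub>R d - ((y - c *\<^sub>R d) - (x - b *\<^sub>R d)))"
        unfolding dist_norm[symmetric]
        by (rule infdist_le[OF subspace_diff[OF E(1) that(2) that(1)]])
      also have "(b - c) *\<^sub>R d - ((y - c *\<^sub>R d) - (x - b *\<^sub>R d)) = x - y"
        by (simp add: algebra_simps)
      finally show ?thesis
        by (simp add: infdist_subspace_scale[OF E(1)] \<delta>_def)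
    qed
    show ?thesis
      unfolding closed_sequential_limits
    proof (intro allI impI)
      fix x l assume asm: "(\<forall>n. x n \<in> E') \<and> x \<longlonglongrightarrow> l"
      then have "\<forall>n. \<exists>c. x n - c *\<^sub>R d \<in> E"
        by (simp add: E'_def)
      then obtain c where c: "\<And>n. x n - c n *\<^sub>R d \<in> E"
        using choice[of "\<lambda>n c. x n - c *\<^sub>R d \<in> E"] by auto
      have "Cauchy c"
      proof (rule metric_CauchyI)
        fix e :: real assume "0 < e"
        have "Cauchy x" using asm by (blast intro: LIMSEQ_imp_Cauchy)
        then obtain N where N: "\<And>m n. N \<le> m \<Longrightarrow> N \<le> n \<Longrightarrow> dist (x m) (x n) < e * \<delta>"
          using metric_CauchyD[of x "e * \<delta>"] \<open>0 < e\<close> \<open>0 < \<delta>\<close> by auto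
        have "dist (c m) (c n) < e" if "N \<le> m" "N \<le> n" for m n
        proof -
          have "\<bar>c m - c n\<bar> * \<delta> < e * \<delta>"
            using coeff[OF c[of m] c[of n]] N[OF that] by (simp add: dist_norm)
          then show ?thesis
            using \<open>0 < \<delta>\<close> by (simp add: dist_norm)
        qed
        then show "\<exists>N. \<forall>m\<ge>N. \<forall>n\<ge>N. dist (c m) (c n) < e" by blast
      qed
      then obtain c' where "c \<longlonglongrightarrow> c'"
        by (auto simp: Cauchy_convergent_iff convergent_def)
      with asm have "(\<lambda>n. x n - c n *\<^sub>R d) \<longlonglongrightarrow> l - c' *\<^sub>R d"
        by (intro tendsto_intros) auto
      then have "l - c' *\<^sub>R d \<in> E"
        by (rule closed_sequentially[OF E(2) c])
      then show "l \<in> E'"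
        by (auto simp: E'_def)
    qed
  qed
qed

lemma proper_subspace_interior:
  fixes E :: "'a::real_normed_vector set"
  assumes "subspace E" "E \<noteq> UNIV"
  shows "interior E = {}"
proof (rule ccontr)
  assume "interior E \<noteq> {}"
  then obtain x r where r: "0 < r" "ball x r \<subseteq> E"
    by (meson all_not_in_conv mem_interior)
  have "y \<in> E" for y
  proof -
    define s where "s = r / (2 * (norm y + 1))"
    have s: "0 < s" using r(1) by (simp add: s_def add_nonneg_pos)
    have "s * norm y < r"
    proof -
      have "norm y < 2 * (norm y + 1)"
        using norm_ge_zero[of y] by (smt (verit))
      then have "r * norm y < r * (2 * (norm y + 1))"
        using r(1) by (rule mult_strict_left_mono)
      then show ?thesis
        by (simp add: s_def divide_less_eq add_nonneg_pos)
    qed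
    then have "x + s *\<^sub>R y \<in> E" "x \<in> E"
      using r s by (auto simp: subset_iff dist_norm)
    then have "inverse s *\<^sub>R ((x + s *\<^sub>R y) - x) \<in> E"
      by (intro subspace_scale subspace_diff assms)
    then show "y \<in> E" using s by simp
  qed
  with assms(2) show False by blast
qed

text \<open>By Baire's theorem, countably many closed sets with empty interior do not cover the
  space; a vector outside all \<open>E n\<close> can be scaled to norm 1.\<close>

lemma outside_countable_union:
  fixes E :: "nat \<Rightarrow> 'a::banach set"
  assumes "\<And>n. subspace (E n)" "\<And>n. closed (E n)" "\<And>n. E n \<noteq> UNIV"
  shows "\<exists>v. norm v \<le> 1 \<and> (\<forall>n. v \<notin> E n)"
proof -
  have "euclidean interior_of \<Union>(range E) = {}"
    using assms proper_subspace_interior[OF assms(1,3)]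
    by (intro Baire_category_alt) (auto simp: completely_metrizable_space_euclidean)
  then have "\<Union>(range E) \<noteq> UNIV"
    by auto
  then obtain v where v: "\<And>n. v \<notin> E n" by auto
  have "v \<noteq> 0"
    using v[of 0] subspace_0[OF assms(1)] by auto
  have "inverse (norm v) *\<^sub>R v \<notin> E n" for n
    using v[of n] subspace_scale[OF assms(1), of "inverse (norm v) *\<^sub>R v" n "norm v"] \<open>v \<noteq> 0\<close> by auto
  moreover have "norm (inverse (norm v) *\<^sub>R v) \<le> 1"
    using \<open>v \<noteq> 0\<close> by simp
  ultimately show ?thesis by blast
qed

section \<open>The vector field\<close>

text \<open>\<open>p n\<close> stands for the distance to the growing subspaces, \<open>h n\<close>
  for a functional that norms \<open>v\<close> modulo them, and \<open>w n x\<close> for a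
  continuous choice of a representative of \<open>x\<close> modulo the kernel of \<open>p n\<close>.
  By \<open>w_h\<close> the earlier functionals do not see it, which makes \<open>h_f0\<close>
  exact. The condition on \<open>M\<close> serves \<open>lam_step\<close>.\<close>

locale seminorm_chain =
  fixes p h :: "nat \<Rightarrow> 'a::banach \<Rightarrow> real" and w :: "nat \<Rightarrow> 'a \<Rightarrow> 'a"
    and v :: 'a and C :: real and M :: nat
  assumes p_add: "p n (x + y) \<le> p n x + p n y"
    and p_scale: "p n (c *\<^sub>R x) = \<bar>c\<bar> * p n x"
    and p_norm: "p n x \<le> norm x"
    and p_Suc: "p (Suc n) x \<le> p n x"
    and p_lim: "(\<lambda>n. p n x) \<longlonglongrightarrow> 0"
    and h_linear: "linear (h n)"
    and h_le: "\<bar>h n x\<bar> \<le> p n x"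
    and h_v: "h n v = p n v"
    and p_v: "0 < p n v" and v_le: "norm v \<le> 1"
    and w_cont: "isCont (w n) x"
    and w_p: "p n (w n x - x) = 0"
    and w_h: "i < n \<Longrightarrow> h i (w n x) = 0"
    and w_norm: "norm (w n x) \<le> C * p n x"
    and C: "1 \<le> C" "40 * C \<le> M"
begin

section \<open>The seminorms and their scales\<close>

lemma M_pos: "0 < M"
  using C by (cases M) auto

lemma p_nonneg: "0 \<le> p n x"
  using h_le[of n x] by linarith

lemma p_minus: "p n (- x) = p n x"
  using p_scale[of n "-1" x] by simp

lemma p_diff_commute: "p n (x - y) = p n (y - x)"
  using p_minus[of n "x - y"] by simp

lemma p_mono: "m \<le> n \<Longrightarrow> p n x \<le> p m x"
  by (rule lift_Suc_antimono_le[where f = "\<lambda>n. p n x"]) (rule p_Suc)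

lemma p_lipschitz: "\<bar>p n x - p n y\<bar> \<le> norm (x - y)"
  using p_add[of n "x - y" y] p_add[of n "y - x" x] p_norm[of n "x - y"] p_diff_commute[of n x y]
  by simp

lemma p_isCont: "isCont (p n) x"
  by (rule seminorm_isCont) (rule p_add p_scale p_norm)+

text \<open>If \<open>p n\<close> grows at relative rate \<open>1 / T n\<close>, its derivative is
  \<open>T n ^ M\<close>, so the root \<open>T n\<close> grows at the constant speed
  \<open>1 / Suc M\<close>.\<close>

definition T :: "nat \<Rightarrow> 'a \<Rightarrow> real" where "T n x = root (Suc M) (p n x)"

lemma T_nonneg: "0 \<le> T n x"
  by (simp add: T_def p_nonneg)

lemma T_power: "T n x ^ Suc M = p n x"
  unfolding T_def by (rule real_root_pow_pos2) (simp_all add: p_nonneg)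

lemma T_mono: "m \<le> n \<Longrightarrow> T n x \<le> T m x"
  by (simp add: T_def p_mono)

lemma T_isCont: "isCont (T n) x"
  unfolding T_def by (rule isCont_o2[OF p_isCont isCont_real_root])

lemma T_lim: "(\<lambda>n. T n x) \<longlonglongrightarrow> 0"
  using tendsto_real_root[OF p_lim[of x], of "Suc M"] by (simp add: T_def)

lemma T_pos_iff: "0 < T n x \<longleftrightarrow> 0 < p n x"
  by (simp add: T_def)

text \<open>The window is so narrow that inside it the drift by \<open>v\<close> outweighs the term
  \<open>lam n x * h n x\<close>, whatever the multiplier is; see \<open>h_rising\<close>.\<close>

definition \<theta> :: "nat \<Rightarrow> real" where "\<theta> n = (p n v / 2)\<^sup>2"

lemma \<theta>_pos: "0 < \<theta> n"
  using p_v[of n] by (simp add: \<theta>_def)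

definition q :: "nat \<Rightarrow> 'a \<Rightarrow> real" where
  "q n x = max 0 (min 1 ((1 + h n x / \<theta> n) / 2))"

lemma q_range: "0 \<le> q n x" "q n x \<le> 1"
  by (auto simp: q_def)

lemma q_one: "\<theta> n \<le> h n x \<Longrightarrow> q n x = 1"
  using \<theta>_pos[of n] by (auto simp: q_def min_def max_def field_simps)

lemma q_zero: "h n x \<le> - \<theta> n \<Longrightarrow> q n x = 0"
  using \<theta>_pos[of n] by (auto simp: q_def min_def max_def field_simps)

lemma h_bounded_linear: "bounded_linear (h n)"
  using h_linear[of n] order_trans[OF h_le p_norm]
  by (intro bounded_linear_intro[where K = 1]) (auto simp: linear_add linear_scale)

lemma q_isCont: "isCont (q n) x"
  unfolding q_def using \<theta>_pos[of n]
  by (intro continuous_intros bounded_linear.isCont[OF h_bounded_linear]) auto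

text \<open>Index \<open>j\<close> votes \<open>q j x\<close> for the direction of motion. Its vote counts fully at its own
  scale \<open>T j x\<close> and fades with the ratio of the scales; this keeps \<open>lam n x\<close> continuous in \<open>x\<close>
  and slowly varying in \<open>n\<close>. A vote of 1 at index \<open>n\<close> forces \<open>lam n x = 1 / T n x\<close>, and
  it is \<open>- 1 / T n x\<close> if all votes are 0.\<close>

definition g :: "nat \<Rightarrow> nat \<Rightarrow> 'a \<Rightarrow> real" where
  "g n j x = q j x * (T j x / (max (T j x) (T n x))\<^sup>2)"

definition B :: "nat \<Rightarrow> 'a \<Rightarrow> real" where "B n x = (SUP j. g n j x)"

text \<open>The interval from 0 to \<open>1 / T n x\<close>, in which \<open>B n x\<close> lies, is
  stretched to the one from \<open>- 1 / T n x\<close> to \<open>1 / T n x\<close>.\<close>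

definition lam :: "nat \<Rightarrow> 'a \<Rightarrow> real" where "lam n x = 2 * B n x - 1 / T n x"

section \<open>Bounds, continuity and slow variation of the multipliers\<close>

lemma g_nonneg: "0 \<le> g n j x"
  by (simp add: g_def q_range T_nonneg)

text \<open>The first bound tends to 0 in \<open>j\<close> and controls the tail of the supremum,
  the second gives the range of \<open>B n\<close>, and the third, free of \<open>T n x\<close>,
  bounds \<open>B n\<close> uniformly in \<open>n\<close> when only low indices vote.\<close>

lemma g_le:
  assumes "0 < T n x"
  shows "g n j x \<le> T j x / (T n x)\<^sup>2" and "g n j x \<le> 1 / T n x" and "g n j x \<le> q j x / T j x"
proof -
  let ?a = "T j x" and ?u = "T n x"
  let ?m = "max ?a ?u"
  have m: "0 < ?m" "?a \<le> ?m" "?u \<le> ?m" "0 \<le> ?a"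
    using assms T_nonneg[of j x] by auto
  have "g n j x \<le> ?a / ?m\<^sup>2"
    unfolding g_def using q_range[of j x] T_nonneg[of j x] by (intro mult_left_le_one_le) auto
  moreover have "?a / ?m\<^sup>2 \<le> ?a / ?u\<^sup>2"
    using assms m by (intro divide_left_mono power_mono) auto
  ultimately show "g n j x \<le> ?a / ?u\<^sup>2" by linarith
  have "?a / ?m\<^sup>2 \<le> ?m / ?m\<^sup>2"
    using m by (intro divide_right_mono) auto
  also have "\<dots> = 1 / ?m"
    using m by (simp add: power2_eq_square)
  also have "\<dots> \<le> 1 / ?u"
    using assms m by (intro divide_left_mono) auto
  finally show "g n j x \<le> 1 / ?u"
    using \<open>g n j x \<le> ?a / ?m\<^sup>2\<close> by linarith
  show "g n j x \<le> q j x / ?a"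
  proof (cases "?a = 0")
    case False
    then have "?a / ?m\<^sup>2 \<le> ?a / ?a\<^sup>2"
      using m by (intro divide_left_mono power_mono) auto
    then have "q j x * (?a / ?m\<^sup>2) \<le> q j x * (1 / ?a)"
      using False by (intro mult_left_mono q_range) (simp add: power2_eq_square)
    then show ?thesis by (simp add: g_def)
  qed (simp add: g_def)
qed

lemma B_upper: "0 < T n x \<Longrightarrow> g n j x \<le> B n x"
  unfolding B_def by (rule cSUP_upper) (auto intro!: bdd_aboveI2[of _ _ "1 / T n x"] g_le)

lemma B_least: "(\<And>j. g n j x \<le> c) \<Longrightarrow> B n x \<le> c"
  unfolding B_def by (rule cSUP_least) auto

lemma B_range: "0 < T n x \<Longrightarrow> 0 \<le> B n x" "0 < T n x \<Longrightarrow> B n x \<le> 1 / T n x"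
  using order_trans[OF g_nonneg B_upper[of n x 0]] by (auto intro: B_least g_le)

text \<open>The maximum \<open>S J\<close> of the votes up to \<open>J\<close> approximates the
  supremum with an error that is continuous at \<open>x\<close> and tends to 0 there, by the first
  bound of \<open>g_le\<close>.\<close>

lemma B_isCont:
  assumes "0 < T n x"
  shows "isCont (B n) x"
proof -
  define S where "S = rec_nat (g n 0) (\<lambda>J s y. max (s y) (g n (Suc J) y))"
  have S: "S 0 = g n 0" "S (Suc J) = (\<lambda>y. max (S J y) (g n (Suc J) y))" for J
    by (simp_all add: S_def)
  have g_cont: "isCont (g n j) x" for j
    unfolding g_def using assms T_nonneg[of j x]
    by (intro continuous_intros q_isCont T_isCont) (auto simp: max_def)
  have S_ge: "g n j y \<le> S J y" if "j \<le> J" for j J y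
    using that by (induction J) (auto simp: S le_Suc_eq le_max_iff_disj)
  have S_le: "S J y \<le> B n y" if "0 < T n y" for J y
    using B_upper[OF that] by (induction J) (auto simp: S)
  have pos: "\<forall>\<^sub>F y in nhds x. 0 < T n y"
    using T_isCont[of x n] assms by (intro order_tendstoD(1)) (auto simp: isCont_def tendsto_at_iff_tendsto_nhds)
  show ?thesis
  proof (rule isCont_approx[where S = S and r = "\<lambda>J y. T J y / (T n y)\<^sup>2"])
    show "isCont (S J) x" for J
      by (induction J) (simp_all add: S g_cont continuous_max)
    show "isCont (\<lambda>y. T J y / (T n y)\<^sup>2) x" for J
      using assms by (intro continuous_intros T_isCont) auto
    show "(\<lambda>J. T J x / (T n x)\<^sup>2) \<longlonglongrightarrow> 0"
      using tendsto_divide[OF T_lim[of x] tendsto_const[of "(T n x)\<^sup>2"]] assms by simp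
    show "\<forall>\<^sub>F y in nhds x. norm (B n y - S J y) \<le> T J y / (T n y)\<^sup>2" for J
      using pos
    proof eventually_elim
      case (elim y)
      have "B n y \<le> S J y + T J y / (T n y)\<^sup>2"
      proof (rule B_least)
        fix j
        show "g n j y \<le> S J y + T J y / (T n y)\<^sup>2"
        proof (cases "j \<le> J")
          case True
          then show ?thesis
            using S_ge[OF True, of y] T_nonneg[of J y] by (smt (verit) divide_nonneg_nonneg zero_le_power2)
        next
          case False
          then have "g n j y \<le> T J y / (T n y)\<^sup>2"
            using g_le(1)[OF elim, of j] T_mono[of J j y] by (smt (verit) divide_right_mono zero_le_power2 nat_le_linear)
          then show ?thesis
            using S_ge[of 0 J y] g_nonneg[of n 0 y] by simp
        qed
      qed
      with S_le[OF elim, of J] show ?case by simp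
    qed
  qed
qed

lemma lam_isCont: "0 < T n x \<Longrightarrow> isCont (lam n) x"
  unfolding lam_def by (intro continuous_intros B_isCont T_isCont) auto

lemma lam_bound: "0 < T n x \<Longrightarrow> \<bar>lam n x\<bar> \<le> 1 / T n x"
  using B_range[of n x] by (auto simp: lam_def abs_le_iff)

lemma lam_plus:
  assumes "0 < T n x" "\<theta> n \<le> h n x"
  shows "1 / T n x \<le> lam n x"
proof -
  have "g n n x = 1 / T n x"
    using assms by (simp add: g_def q_one power2_eq_square)
  with B_upper[OF assms(1), of n] show ?thesis
    by (simp add: lam_def)
qed

text \<open>Bernoulli's inequality for \<open>(u / u') ^ M\<close>, combined with
  \<open>1 - 1 / s \<le> s - 1\<close> for \<open>s = u / u'\<close>.\<close>

lemma power_step: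
  fixes u u' :: real
  assumes "0 < u'" "u' \<le> u"
  shows "M * (u' ^ M * (1 - u' / u)) \<le> u ^ M - u' ^ M"
proof -
  have "1 + M * (u / u' - 1) \<le> (1 + (u / u' - 1)) ^ M"
    using assms by (intro Bernoulli_inequality) (simp add: field_simps)
  then have "u' ^ M * (1 + M * (u / u' - 1)) \<le> u' ^ M * (u / u') ^ M"
    using assms by (intro mult_left_mono) auto
  then have "M * (u' ^ M * (u / u' - 1)) \<le> u ^ M - u' ^ M"
    using assms by (simp add: power_divide algebra_simps)
  moreover have "1 - u' / u \<le> u / u' - 1"
  proof -
    have "2 * (u * u') \<le> u * u + u' * u'"
      using sum_squares_bound[of u u'] by (simp add: power2_eq_square)
    then show ?thesis
      using assms by (simp add: field_simps)
  qed
  then have "M * (u' ^ M * (1 - u' / u)) \<le> M * (u' ^ M * (u / u' - 1))"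
    using assms by (intro mult_left_mono) auto
  ultimately show ?thesis by linarith
qed

text \<open>Passing from the scale \<open>u\<close> to \<open>u'\<close> raises each vote by a
  factor of at most \<open>(u / u')\<^sup>2\<close>, so \<open>lam\<close> changes by at most a
  multiple of \<open>(1 - u' / u) / u'\<close>. Times \<open>p (Suc m) x = u' ^ Suc M\<close>, this
  is of the order of \<open>u' ^ M * (1 - u' / u)\<close>, which \<open>power_step\<close> bounds by
  the decrease of \<open>T ^ M\<close>. Such bounds telescope.\<close>

lemma lam_step:
  "\<bar>lam (Suc m) x - lam m x\<bar> * (C * p (Suc m) x) \<le> (T m x ^ M - T (Suc m) x ^ M) / 8"
proof (cases "0 < T (Suc m) x")
  \<comment> \<open>Here \<open>lam (Suc m) x\<close> is a junk value, but it is multiplied by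
    \<open>p (Suc m) x = 0\<close>.\<close>
  case False
  then have "p (Suc m) x = 0" "T (Suc m) x = 0"
    using T_pos_iff[of "Suc m" x] p_nonneg[of "Suc m" x] T_nonneg[of "Suc m" x] by auto
  then show ?thesis
    using T_nonneg[of m x] M_pos by simp
next
  case True
  define u u' where "u = T m x" and "u' = T (Suc m) x"
  have u: "0 < u'" "u' \<le> u" "0 < u"
    using True T_mono[of m "Suc m" x] by (auto simp: u_def u'_def)
  let ?\<tau> = "u' / u"
  have \<tau>: "0 < ?\<tau>" "?\<tau> \<le> 1"
    using u by auto
  define D where "D = (1 - ?\<tau>) / u'"
  have Tm: "0 < T m x"
    using u by (simp add: u_def)
  have B_mono: "B m x \<le> B (Suc m) x"
  proof (rule B_least)
    fix j
    have "g m j x \<le> g (Suc m) j x"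
      unfolding g_def using True T_nonneg[of j x] T_mono[of m "Suc m" x]
      by (intro mult_left_mono divide_left_mono power_mono q_range max.mono) (auto simp: max_def)
    with B_upper[OF True, of j] show "g m j x \<le> B (Suc m) x" by simp
  qed
  have "B (Suc m) x \<le> B m x / ?\<tau>\<^sup>2"
  proof (rule B_least)
    fix j
    let ?a = "T j x"
    have "?\<tau> * max ?a u \<le> max ?a u'"
    proof -
      have "?\<tau> * ?a \<le> ?a"
        using \<tau> T_nonneg[of j x] by (intro mult_left_le_one_le) auto
      moreover have "?\<tau> * u = u'" using u by simp
      ultimately show ?thesis by (auto simp: max_def)
    qed
    then have "(?\<tau> * max ?a u)\<^sup>2 \<le> (max ?a u')\<^sup>2"
      using u \<tau> by (intro power_mono) (auto simp: max_def T_nonneg)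
    then have "?a / (max ?a u')\<^sup>2 \<le> ?a / (?\<tau> * max ?a u)\<^sup>2"
      using u \<tau> T_nonneg[of j x] by (intro divide_left_mono) (auto simp: max_def)
    then have "g (Suc m) j x \<le> q j x * (?a / (?\<tau> * max ?a u)\<^sup>2)"
      unfolding g_def u'_def[symmetric] by (intro mult_left_mono q_range) auto
    also have "\<dots> = g m j x / ?\<tau>\<^sup>2"
      by (simp add: g_def u_def power_mult_distrib power_divide mult_ac)
    also have "\<dots> \<le> B m x / ?\<tau>\<^sup>2"
      using B_upper[OF Tm, of j] by (intro divide_right_mono) auto
    finally show "g (Suc m) j x \<le> B m x / ?\<tau>\<^sup>2" .
  qed
  then have "?\<tau>\<^sup>2 * B (Suc m) x \<le> B m x"
    using \<tau> by (metis pos_le_divide_eq zero_less_power mult.commute)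
  then have "B (Suc m) x - B m x \<le> (1 - ?\<tau>\<^sup>2) * B (Suc m) x"
    by (simp add: algebra_simps)
  also have "\<dots> \<le> (2 * (1 - ?\<tau>)) * (1 / u')"
  proof (rule mult_mono)
    show "1 - ?\<tau>\<^sup>2 \<le> 2 * (1 - ?\<tau>)"
      using zero_le_power2[of "1 - ?\<tau>"] by (simp add: power2_eq_square algebra_simps)
  qed (use B_range[OF True] \<tau> in \<open>auto simp: u'_def\<close>)
  finally have "B (Suc m) x - B m x \<le> 2 * D"
    by (simp add: D_def)
  moreover have "1 / u' - 1 / u = D"
    using u by (simp add: D_def field_simps)
  moreover have "lam (Suc m) x - lam m x = 2 * (B (Suc m) x - B m x) - (1 / u' - 1 / u)"
    by (simp add: lam_def u_def u'_def algebra_simps)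
  moreover have "0 \<le> D"
    using u \<tau> by (simp add: D_def)
  \<comment> \<open>The change of \<open>2 * B\<close> lies between 0 and \<open>4 * D\<close>, that
    of \<open>1 / T\<close> is \<open>D\<close>.\<close>
  ultimately have "0 \<le> D" "\<bar>lam (Suc m) x - lam m x\<bar> \<le> 5 * D"
    using B_mono by (smt (verit))+
  then have "\<bar>lam (Suc m) x - lam m x\<bar> * (C * p (Suc m) x) \<le> (5 * D) * (C * u' ^ Suc M)"
    unfolding u'_def T_power using C \<open>0 \<le> D\<close> by (intro mult_mono) (auto simp: p_nonneg)
  also have "\<dots> = 5 * C * (u' ^ M * (1 - ?\<tau>))"
    using u by (simp add: D_def)
  \<comment> \<open>The assumption \<open>40 * C \<le> M\<close> is made for this step.\<close>
  also have "\<dots> \<le> (M / 8) * (u' ^ M * (1 - ?\<tau>))"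
    using C u \<tau> by (intro mult_right_mono) auto
  also have "\<dots> \<le> (u ^ M - u' ^ M) / 8"
    using power_step[OF u(1,2)] by simp
  finally show ?thesis
    by (simp add: u_def u'_def)
qed

text \<open>Modulo the kernel of \<open>p n\<close> each \<open>w m x\<close> with \<open>m \<le> n\<close> is \<open>x\<close>, so the partial sums
  telescope to \<open>lam n x *\<^sub>R x\<close>. Where \<open>T n x = 0\<close>, \<open>lam n x\<close> is a junk value multiplying
  \<open>w n x = 0\<close>.\<close>

definition P :: "nat \<Rightarrow> 'a \<Rightarrow> 'a" where
  "P k x = lam 0 x *\<^sub>R w 0 x + (\<Sum>m<k. (lam (Suc m) x - lam m x) *\<^sub>R w (Suc m) x)"

definition f\<^sub>0 :: "'a \<Rightarrow> 'a" where "f\<^sub>0 x = lim (\<lambda>k. P k x)"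

lemma P_Suc: "P (Suc k) x = P k x + (lam (Suc k) x - lam k x) *\<^sub>R w (Suc k) x"
  by (simp add: P_def)

section \<open>Convergence and continuity of the series for the field\<close>

lemma P_step: "norm (P (Suc k) x - P k x) \<le> (T k x ^ M - T (Suc k) x ^ M) / 8"
  using order_trans[OF mult_left_mono[OF w_norm[of "Suc k" x], of "\<bar>lam (Suc k) x - lam k x\<bar>"]
      lam_step[of k x]]
  by (simp add: P_Suc)

lemma P_diff:
  assumes "k \<le> l"
  shows "norm (P l x - P k x) \<le> (T k x ^ M - T l x ^ M) / 8"
  using assms
proof (induction l rule: dec_induct)
  case (step l)
  then show ?case
    using P_step[of l x] norm_triangle_ineq[of "P (Suc l) x - P l x" "P l x - P k x"] by simp
qed simp

lemma P_diff_le: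
  assumes "k \<le> l"
  shows "norm (P l x - P k x) \<le> T k x ^ M / 8"
  by (rule order_trans[OF P_diff[OF assms] divide_right_mono]) (simp_all add: T_nonneg)

lemma T_power_lim: "(\<lambda>n. T n x ^ M) \<longlonglongrightarrow> 0"
  using T_lim M_pos by simp

lemma P_lim: "(\<lambda>k. P k x) \<longlonglongrightarrow> f\<^sub>0 x"
proof -
  have "Cauchy (\<lambda>k. P k x)"
  proof (rule metric_CauchyI)
    fix e :: real assume "0 < e"
    then obtain N where N: "T N x ^ M < e"
      using order_tendstoD(2)[OF T_power_lim[of x], of e] by (auto simp: eventually_sequentially)
    have "dist (P k x) (P l x) < e" if "N \<le> k" "N \<le> l" for k l
    proof -
      have "dist (P k x) (P l x) \<le> dist (P k x) (P N x) + dist (P l x) (P N x)"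
        by (rule dist_triangle2)
      also have "\<dots> \<le> T N x ^ M / 8 + T N x ^ M / 8"
        unfolding dist_norm using that by (intro add_mono P_diff_le)
      finally show ?thesis
        using N \<open>0 < e\<close> by simp
    qed
    then show "\<exists>N. \<forall>k\<ge>N. \<forall>l\<ge>N. dist (P k x) (P l x) < e" by blast
  qed
  then show ?thesis
    by (simp add: f\<^sub>0_def convergent_LIMSEQ_iff[symmetric] Cauchy_convergent)
qed

lemma f0_P: "norm (f\<^sub>0 x - P k x) \<le> T k x ^ M / 8"
proof (rule tendsto_upperbound[OF tendsto_norm[OF tendsto_diff[OF P_lim tendsto_const]]])
  show "\<forall>\<^sub>F l in sequentially. norm (P l x - P k x) \<le> T k x ^ M / 8"
    using P_diff_le by (rule eventually_sequentiallyI)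
qed simp

text \<open>At points with \<open>T n x = 0\<close> the coefficient may be junk. Near them
  \<open>w n\<close> is of the order of \<open>T n ^ Suc M\<close> and the coefficient at most of
  the order of \<open>1 / T n\<close>, so the product tends to 0.\<close>

lemma term_isCont:
  assumes cont: "0 < T n x \<Longrightarrow> isCont c x" and bd: "\<And>y. 0 < T n y \<Longrightarrow> \<bar>c y\<bar> \<le> 2 / T n y"
  shows "isCont (\<lambda>y. c y *\<^sub>R w n y) x"
proof (cases "0 < T n x")
  case True
  then show ?thesis
    by (intro continuous_intros cont w_cont)
next
  case False
  then have T0: "T n x = 0" "p n x = 0"
    using T_nonneg[of n x] T_pos_iff[of n x] p_nonneg[of n x] by auto
  have bound: "norm (c y *\<^sub>R w n y) \<le> 2 * C * T n y ^ M" for y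
  proof (cases "0 < T n y")
    case True
    then have "norm (c y *\<^sub>R w n y) \<le> (2 / T n y) * (C * T n y ^ Suc M)"
      unfolding norm_scaleR T_power by (intro mult_mono w_norm bd) auto
    also have "\<dots> = 2 * C * T n y ^ M"
      using True by simp
    finally show ?thesis .
  next
    case False
    then have "p n y = 0"
      using T_pos_iff[of n y] p_nonneg[of n y] by auto
    then have "w n y = 0"
      using w_norm[of n y] by simp
    then show ?thesis
      using C T_nonneg[of n y] by simp
  qed
  have "w n x = 0"
    using w_norm[of n x] T0 by simp
  moreover have "((\<lambda>y. c y *\<^sub>R w n y) \<longlongrightarrow> 0) (at x)"
  proof (rule Lim_null_comparison)
    show "\<forall>\<^sub>F y in at x. norm (c y *\<^sub>R w n y) \<le> 2 * C * T n y ^ M"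
      using bound by simp
    have "isCont (\<lambda>y. 2 * C * T n y ^ M) x"
      by (intro continuous_intros T_isCont)
    then show "((\<lambda>y. 2 * C * T n y ^ M) \<longlongrightarrow> 0) (at x)"
      using T0 M_pos by (simp add: isCont_def zero_power)
  qed
  ultimately show ?thesis
    by (simp add: isCont_def)
qed

lemma P_isCont: "isCont (P k) x"
proof -
  have "isCont (\<lambda>y. (lam (Suc m) y - lam m y) *\<^sub>R w (Suc m) y) x" for m
  proof (rule term_isCont)
    have pos: "0 < T m y" if "0 < T (Suc m) y" for y
      using that T_mono[of m "Suc m" y] by simp
    show "isCont (\<lambda>y. lam (Suc m) y - lam m y) x" if "0 < T (Suc m) x"
      using that pos by (intro continuous_intros lam_isCont)
    fix y assume y: "0 < T (Suc m) y"
    then have "1 / T m y \<le> 1 / T (Suc m) y"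
      using T_mono[of m "Suc m" y] by (intro divide_left_mono) auto
    then show "\<bar>lam (Suc m) y - lam m y\<bar> \<le> 2 / T (Suc m) y"
      using lam_bound[OF y] lam_bound[OF pos[OF y]] by (auto simp: abs_le_iff)
  qed
  moreover have "isCont (\<lambda>y. lam 0 y *\<^sub>R w 0 y) x"
    by (rule term_isCont) (use lam_isCont lam_bound T_nonneg in \<open>force simp: field_simps\<close>)+
  ultimately show ?thesis
    unfolding P_def by (intro continuous_add continuous_sum) auto
qed

lemma f0_isCont: "isCont f\<^sub>0 x"
proof (rule isCont_approx[where S = P and r = "\<lambda>k y. T k y ^ M / 8"])
  show "(\<lambda>k. T k x ^ M / 8) \<longlonglongrightarrow> 0"
    using tendsto_divide[OF T_power_lim[of x] tendsto_const[of 8]] by simp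
  show "isCont (\<lambda>y. T k y ^ M / 8) x" for k
    by (intro continuous_intros T_isCont) simp
  show "\<forall>\<^sub>F y in nhds x. norm (f\<^sub>0 y - P k y) \<le> T k y ^ M / 8" for k
    using f0_P by (rule always_eventually[OF allI])
qed (rule P_isCont)

lemma P_congruent: "p n (P n x - lam n x *\<^sub>R x) = 0"
proof -
  have "p n (P k x - lam k x *\<^sub>R x) = 0" if "k \<le> n" for k
    using that
  proof (induction k)
    case 0
    have "p n (P 0 x - lam 0 x *\<^sub>R x) = \<bar>lam 0 x\<bar> * p n (w 0 x - x)"
      by (simp add: P_def p_scale flip: scaleR_diff_right)
    then show ?case
      using p_mono[of 0 n "w 0 x - x"] w_p[of 0 x] p_nonneg[of n "w 0 x - x"] by simp
  next
    case (Suc k)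
    let ?d = "lam (Suc k) x - lam k x"
    have "P (Suc k) x - lam (Suc k) x *\<^sub>R x
        = (P k x - lam k x *\<^sub>R x) + ?d *\<^sub>R (w (Suc k) x - x)"
      by (simp add: P_Suc algebra_simps)
    moreover have "p n (?d *\<^sub>R (w (Suc k) x - x)) = 0"
      using p_mono[of "Suc k" n "w (Suc k) x - x"] w_p[of "Suc k" x]
        p_nonneg[of n "w (Suc k) x - x"] Suc.prems by (simp add: p_scale)
    ultimately show ?case
      using p_add[of n "P k x - lam k x *\<^sub>R x" "?d *\<^sub>R (w (Suc k) x - x)"] Suc
        p_nonneg[of n "P (Suc k) x - lam (Suc k) x *\<^sub>R x"] by simp
  qed
  then show ?thesis by simp
qed

lemma p_f0: "p n (f\<^sub>0 x - lam n x *\<^sub>R x) \<le> T n x ^ M / 8"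
proof -
  have "p n (f\<^sub>0 x - lam n x *\<^sub>R x) \<le> p n (f\<^sub>0 x - P n x) + p n (P n x - lam n x *\<^sub>R x)"
    using p_add[of n "f\<^sub>0 x - P n x" "P n x - lam n x *\<^sub>R x"] by simp
  with p_norm[of n "f\<^sub>0 x - P n x"] f0_P[of x n] show ?thesis
    by (simp add: P_congruent)
qed

text \<open>\<open>h n\<close> annihilates the terms with index above \<open>n\<close> by
  \<open>w_h\<close>, and it does not distinguish \<open>P n x\<close> from
  \<open>lam n x *\<^sub>R x\<close> because it is dominated by \<open>p n\<close>. So there is no
  error term, in contrast to \<open>p_f0\<close>.\<close>

lemma h_f0: "h n (f\<^sub>0 x) = lam n x * h n x"
proof -
  interpret h: bounded_linear "h n" by (rule h_bounded_linear)
  have "h n (P k x) = lam n x * h n x" if "n \<le> k" for k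
    using that
  proof (induction k rule: dec_induct)
    case base
    have "\<bar>h n (P n x - lam n x *\<^sub>R x)\<bar> \<le> 0"
      using h_le[of n "P n x - lam n x *\<^sub>R x"] by (simp add: P_congruent)
    then show ?case
      by (simp add: h.diff h.scaleR)
  next
    case (step k)
    then show ?case
      by (simp add: P_Suc h.add h.scaleR w_h)
  qed
  then have "(\<lambda>k. h n (P k x)) \<longlonglongrightarrow> lam n x * h n x"
    by (intro tendsto_eventually) (auto simp: eventually_sequentially)
  with h.tendsto[OF P_lim[of x]] show ?thesis
    using LIMSEQ_unique by blast
qed

section \<open>Behaviour along solutions\<close>

definition f :: "'a \<Rightarrow> 'a" where "f x = f\<^sub>0 x + v"

lemma f_continuous: "continuous_on UNIV f"
  unfolding f_def by (intro continuous_at_imp_continuous_on ballI continuous_intros f0_isCont)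

lemma h_f: "h n (f x) = lam n x * h n x + p n v"
  by (simp add: f_def linear_add[OF h_linear] h_f0 h_v)

text \<open>The term \<open>lam n x * h n x\<close> costs at most half of the drift
  \<open>p n v\<close>. Above the window it is nonnegative. Inside, \<open>\<bar>h n x\<bar>\<close>
  is at most \<open>\<theta> n\<close> and, if \<open>T n x \<le> 1\<close>, at most
  \<open>(T n x)\<^sup>2\<close>; the product of these bounds gives
  \<open>\<bar>h n x\<bar> / T n x \<le> p n v / 2\<close>.\<close>

lemma h_rising:
  assumes "- \<theta> n \<le> h n x"
  shows "p n v / 2 \<le> h n (f x)"
proof -
  consider "T n x = 0" | "0 < T n x" "\<theta> n \<le> h n x" | "0 < T n x" "\<bar>h n x\<bar> \<le> \<theta> n"
    using assms T_nonneg[of n x]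
    by (cases "T n x = 0"; cases "\<theta> n \<le> h n x") (auto simp: abs_le_iff less_le)
  then have "- (p n v / 2) \<le> lam n x * h n x"
  proof cases
    case 1
    then have "p n x = 0"
      using T_power[of n x] by simp
    with h_le[of n x] p_v[of n] show ?thesis by simp
  next
    case 2
    have "0 \<le> 1 / T n x" using 2 by simp
    with lam_plus[OF 2] have "0 \<le> lam n x" by linarith
    with 2 \<theta>_pos[of n] p_v[of n] show ?thesis
      by (smt (verit) mult_nonneg_nonneg half_gt_zero)
  next
    case 3
    have "\<bar>h n x\<bar> / T n x \<le> p n v / 2"
    proof (cases "T n x \<le> 1")
      case True
      have "\<bar>h n x\<bar> \<le> (T n x)\<^sup>2"
        using h_le[of n x] power_decreasing[of 2 "Suc M" "T n x"] True T_nonneg[of n x] M_pos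
        by (simp add: T_power[symmetric])
      then have "\<bar>h n x\<bar> * \<bar>h n x\<bar> \<le> \<theta> n * (T n x)\<^sup>2"
        using 3 by (intro mult_mono) auto
      then have "\<bar>h n x\<bar>\<^sup>2 / (T n x)\<^sup>2 \<le> \<theta> n"
        using 3 by (simp add: pos_divide_le_eq power2_eq_square del: abs_mult_self_eq)
      then have "(\<bar>h n x\<bar> / T n x)\<^sup>2 \<le> (p n v / 2)\<^sup>2"
        by (simp only: power_divide \<theta>_def)
      then show ?thesis
        by (rule power2_le_imp_le) (use p_v[of n] in simp)
    next
      case False
      then have "\<bar>h n x\<bar> / T n x \<le> \<bar>h n x\<bar>"
        using divide_left_mono[of 1 "T n x" "\<bar>h n x\<bar>"] by simp
      also have "\<dots> \<le> (p n v / 2) * (p n v / 2)"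
        using 3 by (simp add: \<theta>_def power2_eq_square)
      also have "\<dots> \<le> p n v / 2"
        using p_v[of n] order_trans[OF p_norm[of n v] v_le] by (intro mult_left_le_one_le) auto
      finally show ?thesis .
    qed
    moreover have "\<bar>lam n x * h n x\<bar> \<le> \<bar>h n x\<bar> / T n x"
      using mult_right_mono[OF lam_bound[OF 3(1)], of "\<bar>h n x\<bar>"] by (simp add: abs_mult)
    ultimately show ?thesis by linarith
  qed
  then show ?thesis
    by (simp add: h_f)
qed

text \<open>With \<open>W = T n x ^ M\<close>, the multiplier raises \<open>p n\<close> by at least
  \<open>h * W / 2\<close> in an Euler step of length \<open>h\<close>. The error of the field, the
  vector \<open>v\<close> and the linearization take away at most \<open>h * W / 8\<close> each, and
  the remaining \<open>h * W / 8\<close> suffices for the growth of \<open>T n\<close>. The sign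
  \<open>\<sigma> = -1\<close> serves reversed time.\<close>

lemma T_growth:
  assumes "a \<le> e" and \<sigma>: "\<bar>\<sigma>\<bar> = 1"
    and deriv: "\<And>s. s \<in> {a..e} \<Longrightarrow> (z has_vector_derivative \<sigma> *\<^sub>R f (z s)) (at s)"
    and pos: "\<And>s. s \<in> {a..e} \<Longrightarrow> 0 < T n (z s)"
    and rate: "\<And>s. s \<in> {a..e} \<Longrightarrow> 1 / (2 * T n (z s)) \<le> \<sigma> * lam n (z s)"
    and kick: "\<And>s. s \<in> {a..e} \<Longrightarrow> p n v \<le> T n (z s) ^ M / 8"
  shows "(e - a) / (16 * Suc M) \<le> T n (z e)"
proof -
  \<comment> \<open>Makes \<open>(T n x + k * h) ^ Suc M\<close> grow at the initial rate
    \<open>W / 16\<close>, strictly below the available \<open>W / 8\<close>.\<close>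
  define k where "k = 1 / (16 * Suc M)"
  have "T n (z a) + k * (e - a) \<le> T n (z e)"
  proof (rule continuous_linear_growth[OF \<open>a \<le> e\<close>])
    have "isCont (\<lambda>s. T n (z s)) s" if "s \<in> {a..e}" for s
      by (rule isCont_o2[OF has_vector_derivative_continuous[OF deriv[OF that]] T_isCont])
    then show "continuous_on {a..e} (\<lambda>s. T n (z s))"
      by (simp add: continuous_at_imp_continuous_on)
    fix s assume "a \<le> s" "s < e"
    then have s: "s \<in> {a..e}" by simp
    define x where "x = z s"
    define W where "W = T n x ^ M"
    have T: "0 < T n x" "0 < W" and \<rho>: "p n x = T n x * W"
      using pos[OF s] T_power[of n x] by (auto simp: x_def W_def)
    have "((\<lambda>h. norm (z (s + h) - z s - h *\<^sub>R \<sigma> *\<^sub>R f x) / norm h) \<longlongrightarrow> 0) (at_right 0)"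
      using deriv[OF s] unfolding has_vector_derivative_def has_derivative_at x_def
      by (auto intro: filterlim_mono[OF _ order_refl at_le])
    then have lin: "\<forall>\<^sub>F h in at_right 0. norm (z (s + h) - z s - h *\<^sub>R \<sigma> *\<^sub>R f x) / norm h < W / 8"
      using T by (intro order_tendstoD) auto
    have "((\<lambda>h. (T n x + k * h) ^ Suc M) has_real_derivative real (Suc M) * k * W) (at 0)"
      by (auto intro!: derivative_eq_intros simp: W_def mult_ac simp del: power_Suc)
    moreover have "real (Suc M) * k * W = W / 16"
      unfolding k_def of_nat_mult by (simp del: of_nat_Suc)
    ultimately have "((\<lambda>h. (T n x + k * h) ^ Suc M) has_real_derivative W / 16) (at 0)"
      by (simp only:)
    then have "((\<lambda>h. ((T n x + k * h) ^ Suc M - T n x ^ Suc M) / h) \<longlongrightarrow> W / 16) (at_right 0)"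
      by (auto simp: DERIV_def simp del: power_Suc intro: filterlim_mono[OF _ order_refl at_le])
    then have pow: "\<forall>\<^sub>F h in at_right 0. ((T n x + k * h) ^ Suc M - T n x ^ Suc M) / h < W / 8"
      using T by (intro order_tendstoD) auto
    show "\<forall>\<^sub>F h in at_right 0. T n (z s) + k * h \<le> T n (z (s + h))"
      using lin pow eventually_at_right_less[of "0::real"]
    proof eventually_elim
      case (elim h)
      let ?y = "x + h *\<^sub>R \<sigma> *\<^sub>R f x"
      have "W / 2 \<le> \<sigma> * lam n x * p n x"
      proof -
        have "1 / (2 * T n x) * p n x = W / 2"
          using T by (simp add: \<rho>)
        then show ?thesis
          using mult_right_mono[OF rate[OF s, folded x_def] p_nonneg[of n x]] by simp
      qed
      then have "h * (W / 2) \<le> h * (\<sigma> * lam n x * p n x)"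
        using elim by (intro mult_left_mono) auto
      then have "p n x + h * (W / 2) \<le> (1 + h * \<sigma> * lam n x) * p n x"
        by (simp add: algebra_simps)
      also have "\<dots> \<le> p n ((1 + h * \<sigma> * lam n x) *\<^sub>R x)"
        unfolding p_scale by (intro mult_right_mono p_nonneg) auto
      also have "(1 + h * \<sigma> * lam n x) *\<^sub>R x =
          ?y + ((- (h * \<sigma>)) *\<^sub>R (f\<^sub>0 x - lam n x *\<^sub>R x) + (- (h * \<sigma>)) *\<^sub>R v)"
        by (simp add: f_def algebra_simps)
      also have "p n \<dots> \<le> p n ?y + (p n ((- (h * \<sigma>)) *\<^sub>R (f\<^sub>0 x - lam n x *\<^sub>R x)) + p n ((- (h * \<sigma>)) *\<^sub>R v))"
        by (intro order_trans[OF p_add] add_left_mono p_add)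
      also have "\<dots> = p n ?y + (h * p n (f\<^sub>0 x - lam n x *\<^sub>R x) + h * p n v)"
        unfolding p_scale using elim \<sigma> by (simp add: abs_mult)
      also have "\<dots> \<le> p n ?y + (h * (W / 8) + h * (W / 8))"
        using p_f0[of n x] kick[OF s] elim by (intro add_mono mult_left_mono) (auto simp: W_def x_def)
      finally have "p n x + h * (W / 4) \<le> p n ?y"
        by (simp add: algebra_simps)
      moreover have "p n ?y \<le> p n (z (s + h)) + norm (z (s + h) - z s - h *\<^sub>R \<sigma> *\<^sub>R f x)"
        using p_lipschitz[of n ?y "z (s + h)"] by (simp add: x_def norm_minus_commute algebra_simps)
      moreover have "norm (z (s + h) - z s - h *\<^sub>R \<sigma> *\<^sub>R f x) \<le> h * (W / 8)"
        using elim by (simp add: divide_less_eq mult.commute)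
      moreover have "(T n x + k * h) ^ Suc M \<le> p n x + h * (W / 8)"
        using elim by (simp add: divide_less_eq mult.commute T_power[symmetric] del: power_Suc)
      ultimately have "(T n x + k * h) ^ Suc M \<le> p n (z (s + h))"
        by (simp del: power_Suc)
      then have "(T n x + k * h) ^ Suc M \<le> T n (z (s + h)) ^ Suc M"
        by (simp only: T_power)
      then show ?case
        using power_le_imp_le_base T_nonneg unfolding x_def by blast
    qed
  qed
  then show ?thesis
    using T_nonneg[of n "z a"] by (simp add: k_def)
qed

text \<open>Dini's argument: the open sets where \<open>T n\<close> is below \<open>r\<close>
  increase with \<open>n\<close> and cover the compact set.\<close>

lemma T_uniform:
  assumes "compact K" "0 < r"
  shows "\<exists>N. \<forall>n\<ge>N. \<forall>x\<in>K. T n x < r"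
proof -
  have cover: "K \<subseteq> (\<Union>n\<in>UNIV. {x. T n x < r})"
    using order_tendstoD(2)[OF T_lim \<open>0 < r\<close>] by (force simp: eventually_sequentially)
  have op: "open {x. T n x < r}" for n
    by (intro open_Collect_less continuous_at_imp_continuous_on ballI T_isCont continuous_intros)
  obtain A where A: "A \<subseteq> UNIV" "finite A" "K \<subseteq> (\<Union>n\<in>A. {x. T n x < r})"
    by (rule compactE_image[OF \<open>compact K\<close> op cover])
  have "T n x < r" if nx: "Max (insert 0 A) \<le> n" "x \<in> K" for n x
  proof -
    obtain m where "m \<in> A" "T m x < r"
      using A(3) nx(2) by blast
    moreover have "m \<le> n"
      using A(2) \<open>m \<in> A\<close> nx(1) by (meson Max_ge finite_insert insertCI order_trans)
    ultimately show ?thesis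
      using T_mono[of m n x] by simp
  qed
  then show ?thesis by blast
qed

lemma h_derivative:
  assumes "(x has_vector_derivative f (x t)) (at t)"
  shows "((\<lambda>t. h n (x t)) has_real_derivative h n (f (x t))) (at t)"
  using bounded_linear.has_vector_derivative[OF h_bounded_linear assms]
  by (simp add: has_real_derivative_iff_has_vector_derivative)

text \<open>The claimed bound keeps \<open>h n\<close> from falling below the window, so
  \<open>h_rising\<close> stays applicable and gives the rate \<open>p n v / 2\<close>, strictly
  above \<open>p n v / 4\<close>.\<close>

lemma h_persistent:
  assumes "s \<le> t" and deriv: "\<And>r. r \<in> {s..t} \<Longrightarrow> (x has_vector_derivative f (x r)) (at r)"
    and "- \<theta> n \<le> h n (x s)"
  shows "h n (x s) + p n v / 4 * (t - s) \<le> h n (x t)"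
proof (rule derivative_linear_growth[OF \<open>s \<le> t\<close> h_derivative[OF deriv]])
  fix r assume r: "r \<in> {s..t}" "h n (x s) + p n v / 4 * (r - s) \<le> h n (x r)"
  have "0 \<le> p n v / 4 * (r - s)"
    using p_nonneg r by simp
  then have "p n v / 2 \<le> h n (f (x r))"
    using r assms(3) by (intro h_rising) linarith
  then show "p n v / 4 < h n (f (x r))"
    using p_v[of n] by linarith
qed

text \<open>As \<open>p n x = T n x * T n x ^ M\<close>, a small factor \<open>T n x\<close> forces
  the other one to be large compared with \<open>p n v\<close>. This yields the assumption
  \<open>kick\<close> of \<open>T_growth\<close> once \<open>h n\<close> has moved away from 0 for a
  time \<open>\<delta>\<close>.\<close>

lemma kick_small:
  assumes "p n v * \<delta> / 8 \<le> p n x" "T n x < \<delta> / 64" "0 < \<delta>"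
  shows "p n v \<le> T n x ^ M / 8"
proof -
  have "p n v * \<delta> / 8 \<le> T n x * T n x ^ M"
    using assms(1) T_power[of n x] by simp
  also have "\<dots> \<le> \<delta> / 64 * T n x ^ M"
    using assms by (intro mult_right_mono) (auto simp: T_nonneg)
  finally have "\<delta> * p n v \<le> \<delta> * (T n x ^ M / 8)"
    by simp
  then show ?thesis
    using \<open>0 < \<delta>\<close> by simp
qed

text \<open>Forward motion is studied to the right of the midpoint \<open>e\<close>, backward motion
  to its left. Each half is halved again: next to \<open>e\<close>, \<open>h n\<close> moves so far
  from 0 that \<open>v\<close> becomes negligible at scale \<open>n\<close>; in the other quarter
  \<open>T n\<close> outgrows its uniform smallness.\<close>

theorem no_solution:
  assumes "a < b" and deriv: "\<And>t. t \<in> {a..b} \<Longrightarrow> (x has_vector_derivative f (x t)) (at t)"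
  shows False
proof -
  define e where "e = (a + b) / 2"
  have e: "a < e" "e < b"
    using \<open>a < b\<close> by (auto simp: e_def)
  define K where "K = x ` {a..b}"
  have "continuous_on {a..b} x"
    using has_vector_derivative_continuous[OF deriv] by (simp add: continuous_at_imp_continuous_on)
  then have "compact K"
    unfolding K_def by (intro compact_continuous_image) auto
  show False
  proof (cases "\<forall>N. \<exists>n\<ge>N. - \<theta> n \<le> h n (x e)")
    case True
    define \<delta> where "\<delta> = (b - e) / 2"
    have \<delta>: "0 < \<delta>" "e + \<delta> < b" "b - (e + \<delta>) = \<delta>"
      using e by (auto simp: \<delta>_def field_simps)
    obtain N where N: "T n y < min (\<delta> / 64) (\<delta> / (16 * Suc M))" if "N \<le> n" "y \<in> K" for n y
      using T_uniform[OF \<open>compact K\<close>, of "min (\<delta> / 64) (\<delta> / (16 * Suc M))"] \<delta> by auto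
    \<comment> \<open>This makes \<open>\<theta> n\<close> at most
      \<open>p n v * \<delta> / 8\<close>, so a rise by \<open>p n v * \<delta> / 4\<close> carries
      \<open>h n\<close> across the whole window.\<close>
    obtain N' where N': "p n v < \<delta> / 2" if "N' \<le> n" for n
      using order_tendstoD(2)[OF p_lim[of v], of "\<delta> / 2"] \<delta> by (auto simp: eventually_sequentially)
    obtain n where n: "N \<le> n" "N' \<le> n" "- \<theta> n \<le> h n (x e)"
      using True[rule_format, of "max N N'"] by auto
    have h_big: "p n v * \<delta> / 8 \<le> h n (x t)" "\<theta> n \<le> h n (x t)" if "t \<in> {e + \<delta>..b}" for t
    proof -
      have "- \<theta> n + p n v / 4 * \<delta> \<le> h n (x e) + p n v / 4 * (t - e)"
        using that n p_nonneg[of n v] by (intro add_mono mult_left_mono) auto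
      also have "\<dots> \<le> h n (x t)"
        using that \<delta> e by (intro h_persistent deriv n) auto
      finally have "- \<theta> n + p n v * \<delta> / 4 \<le> h n (x t)" by simp
      moreover have "\<theta> n \<le> p n v * \<delta> / 8"
        using mult_left_mono[OF less_imp_le[OF N'[OF n(2)]] p_nonneg[of n v]]
        by (simp add: \<theta>_def power2_eq_square)
      ultimately show "p n v * \<delta> / 8 \<le> h n (x t)" "\<theta> n \<le> h n (x t)" by linarith+
    qed
    have big: "p n v * \<delta> / 8 \<le> p n (x t)" if "t \<in> {e + \<delta>..b}" for t
      using h_big(1)[OF that] h_le[of n "x t"] by linarith
    have small: "T n (x t) < min (\<delta> / 64) (\<delta> / (16 * Suc M))" if "t \<in> {e + \<delta>..b}" for t
      using that e \<delta> n by (intro N) (auto simp: K_def)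
    have T: "0 < T n (x t)" if "t \<in> {e + \<delta>..b}" for t
      unfolding T_pos_iff using \<delta> p_v[of n]
      by (intro less_le_trans[OF _ big[OF that]]) (auto intro!: mult_pos_pos)
    have "(b - (e + \<delta>)) / (16 * Suc M) \<le> T n (x b)"
    proof (rule T_growth[where \<sigma> = 1])
      fix t assume t: "t \<in> {e + \<delta>..b}"
      show "(x has_vector_derivative 1 *\<^sub>R f (x t)) (at t)"
        using deriv[of t] t e \<delta> by simp
      have "1 / (2 * T n (x t)) \<le> 1 / T n (x t)"
        using T[OF t] by (simp add: field_simps)
      then show "1 / (2 * T n (x t)) \<le> 1 * lam n (x t)"
        using lam_plus[OF T[OF t] h_big(2)[OF t]] by simp
      show "p n v \<le> T n (x t) ^ M / 8"
        using small[OF t] \<delta> by (intro kick_small[OF big[OF t]]) auto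
    qed (use \<delta> T in auto)
    then show False
      using small[of b] \<delta> by simp
  next
    case False
    then obtain N where N: "h n (x e) < - \<theta> n" if "N \<le> n" for n
      by (meson not_le)
    have neg: "h n (x t) < - \<theta> n" if "N \<le> n" "t \<in> {a..e}" for n t
    proof (rule ccontr)
      assume "\<not> h n (x t) < - \<theta> n"
      then have "- \<theta> n \<le> h n (x t)" by simp
      moreover from this have "h n (x t) + p n v / 4 * (e - t) \<le> h n (x e)"
        using that e by (intro h_persistent deriv) auto
      moreover have "0 \<le> p n v / 4 * (e - t)"
        using that p_nonneg by simp
      ultimately show False
        using N[OF that(1)] by linarith
    qed
    \<comment> \<open>A lower bound for all \<open>T j\<close> with \<open>j \<le> N\<close> on the
      left half. Only indices below \<open>N\<close> can vote there, so \<open>B n\<close> stays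
      below \<open>1 / \<tau>\<close> while \<open>1 / T n\<close> becomes large.\<close>
    define \<tau> where "\<tau> = root (Suc M) (\<theta> N)"
    have "0 < \<tau>"
      by (simp add: \<tau>_def \<theta>_pos)
    have \<tau>: "\<tau> \<le> T N (x t)" if "t \<in> {a..e}" for t
    proof -
      have "\<theta> N \<le> p N (x t)"
        using neg[OF order_refl that] h_le[of N "x t"] by linarith
      then show ?thesis
        by (simp add: \<tau>_def T_def)
    qed
    define \<delta> where "\<delta> = (e - a) / 2"
    have \<delta>: "0 < \<delta>" "a + \<delta> < e" "e - (a + \<delta>) = \<delta>"
      using e by (auto simp: \<delta>_def field_simps)
    \<comment> \<open>\<open>\<tau> / 4\<close> ensures
      \<open>2 / \<tau> \<le> 1 / (2 * T n (x t))\<close>, \<open>\<delta> / 64\<close> is for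
      \<open>kick_small\<close>, and the last entry is the value that \<open>T n\<close> reaches by
      \<open>T_growth\<close>.\<close>
    let ?r = "min (\<tau> / 4) (min (\<delta> / 64) (\<delta> / (16 * Suc M)))"
    obtain N' where N': "T n y < ?r" if "N' \<le> n" "y \<in> K" for n y
      using T_uniform[OF \<open>compact K\<close>, of ?r] \<delta> \<open>0 < \<tau>\<close> by auto
    define n where "n = max N N'"
    have "N \<le> n" "N' \<le> n"
      by (auto simp: n_def)
    have small: "T n (x t) < ?r" if "t \<in> {a..e}" for t
      using that e \<open>N' \<le> n\<close> by (intro N') (auto simp: K_def)
    have T: "0 < T n (x t)" if "t \<in> {a..e}" for t
      using neg[OF \<open>N \<le> n\<close> that] \<theta>_pos[of n] h_le[of n "x t"] unfolding T_pos_iff by linarith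
    have rate: "1 / (2 * T n (x t)) \<le> - lam n (x t)" if t: "t \<in> {a..e}" for t
    proof -
      have "B n (x t) \<le> 1 / \<tau>"
      proof (rule B_least)
        fix j
        show "g n j (x t) \<le> 1 / \<tau>"
        proof (cases "N \<le> j")
          case True
          then have "q j (x t) = 0"
            using neg[OF True t] by (intro q_zero) simp
          then show ?thesis
            using \<open>0 < \<tau>\<close> by (simp add: g_def)
        next
          case False
          then have le: "\<tau> \<le> T j (x t)"
            using \<tau>[OF t] T_mono[of j N "x t"] by simp
          have "g n j (x t) \<le> q j (x t) / T j (x t)"
            by (rule g_le[OF T[OF t]])
          also have "\<dots> \<le> 1 / \<tau>"
            using le \<open>0 < \<tau>\<close> by (intro frac_le q_range) auto
          finally show ?thesis .
        qed
      qed
      moreover have "2 * (1 / \<tau>) \<le> 1 / (2 * T n (x t))"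
        using small[OF t] T[OF t] \<open>0 < \<tau>\<close> by (simp add: field_simps)
      moreover have "1 / T n (x t) = 1 / (2 * T n (x t)) + 1 / (2 * T n (x t))"
        by simp
      ultimately show ?thesis
        unfolding lam_def by (smt (verit))
    qed
    have big: "p n v * \<delta> / 8 \<le> p n (x t)" if t: "t \<in> {a..a + \<delta>}" for t
    proof -
      \<comment> \<open>Since \<open>lam n\<close> and \<open>h n\<close> are both nonpositive here,
        \<open>h n\<close> has derivative at least \<open>p n v\<close>; being negative at
        \<open>e\<close>, it is far below 0 at earlier times.\<close>
      have "h n (x t) + p n v / 2 * (e - t) \<le> h n (x e)"
      proof (rule derivative_linear_growth[OF _ h_derivative[OF deriv]])
        fix s assume "s \<in> {t..e}"
        then have s: "s \<in> {a..e}" using t by simp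
        have "0 \<le> 1 / (2 * T n (x s))" using T[OF s] by simp
        then have "lam n (x s) \<le> 0" "h n (x s) \<le> 0"
          using rate[OF s] neg[OF \<open>N \<le> n\<close> s] \<theta>_pos[of n] by linarith+
        then show "p n v / 2 < h n (f (x s))"
          using p_v[of n] mult_nonpos_nonpos[of "lam n (x s)" "h n (x s)"] by (simp add: h_f)
      qed (use t \<delta> e in auto)
      moreover have "p n v / 8 * \<delta> \<le> p n v / 2 * (e - t)"
        using t \<delta> p_nonneg[of n v] by (intro mult_mono) auto
      moreover have "h n (x e) \<le> 0"
        using N[OF \<open>N \<le> n\<close>] \<theta>_pos[of n] by linarith
      ultimately have "h n (x t) \<le> - (p n v / 8 * \<delta>)"
        by linarith
      then show ?thesis
        using h_le[of n "x t"] by simp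
    qed
    \<comment> \<open>The solution run backwards from \<open>a + \<delta>\<close> to
      \<open>a\<close>.\<close>
    define z where "z s = x (a + \<delta> - s)" for s
    have "(\<delta> - 0) / (16 * Suc M) \<le> T n (z \<delta>)"
    proof (rule T_growth[where \<sigma> = "-1"])
      fix s assume "s \<in> {0..\<delta>}"
      then have s: "a + \<delta> - s \<in> {a..a + \<delta>}" "a + \<delta> - s \<in> {a..e}" "a + \<delta> - s \<in> {a..b}"
        using \<delta> e by auto
      have "((\<lambda>s. a + \<delta> - s) has_vector_derivative - 1) (at s)"
        by (auto intro!: derivative_eq_intros)
      from vector_diff_chain_at[OF this deriv[OF s(3)]]
      show "(z has_vector_derivative - 1 *\<^sub>R f (z s)) (at s)"
        by (simp add: z_def[abs_def] o_def)
      show "0 < T n (z s)" "1 / (2 * T n (z s)) \<le> - 1 * lam n (z s)"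
        using T[OF s(2)] rate[OF s(2)] by (auto simp: z_def)
      show "p n v \<le> T n (z s) ^ M / 8"
        unfolding z_def using small[OF s(2)] \<delta> by (intro kick_small[OF big[OF s(1)]]) auto
    qed (use \<delta> in auto)
    then show False
      using small[of a] e by (simp add: z_def)
  qed
qed

end

section \<open>Separable quotients\<close>

lemma separable_quotient_dense_sequence:
  fixes Z :: "'a::real_normed_vector set"
  assumes Z: "subspace Z" "closed Z" and sep: "separable_quotient Z"
  shows "\<exists>d :: nat \<Rightarrow> 'a. \<forall>x e. 0 < e \<longrightarrow> (\<exists>k. infdist (x - d k) Z < e)"
proof -
  interpret Q: Metric_space "quotient_space Z" "quotient_dist Z"
    by (rule Metric_space_quotient[OF Z])
  obtain C where C: "countable C" "C \<subseteq> quotient_space Z" "Q.mtopology closure_of C = quotient_space Z"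
    using sep by (auto simp: separable_quotient_def separable_space_def)
  have near: "\<exists>A\<in>C. quotient_dist Z (coset Z x) A < e" if "0 < e" for x e
  proof -
    have "coset Z x \<in> Q.mtopology closure_of C"
      by (simp add: C(3) coset_in_quotient_space)
    then show ?thesis
      using that by (auto simp: Q.metric_closure_of)
  qed
  have "C \<noteq> {}"
    using near[of 1] by auto
  then have C_eq: "range (from_nat_into C) = C"
    using C(1) by (rule range_from_nat_into)
  have "\<forall>k. \<exists>y. from_nat_into C k = coset Z y"
    using C(2) from_nat_into[OF \<open>C \<noteq> {}\<close>] by (fastforce simp: quotient_space_def)
  then obtain d where d: "\<And>k. from_nat_into C k = coset Z (d k)"
    using choice[of "\<lambda>k y. from_nat_into C k = coset Z y"] by blast
  have "\<exists>k. infdist (x - d k) Z < e" if "0 < e" for x e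
  proof -
    obtain A where A: "A \<in> C" "quotient_dist Z (coset Z x) A < e"
      using near \<open>0 < e\<close> by blast
    then obtain k where "A = coset Z (d k)"
      using C_eq d by (metis imageE)
    with A show ?thesis
      by (auto simp: quotient_dist_coset[OF Z(1)])
  qed
  then show ?thesis by blast
qed

section \<open>Finite extensions of \<open>Z\<close> and the construction of the chain\<close>

lemma quotient_span_subset: "subspace Z \<Longrightarrow> S \<subseteq> quotient_space Z \<Longrightarrow> quotient_span Z S \<subseteq> quotient_space Z"
proof
  fix A assume Z: "subspace Z" and S: "S \<subseteq> quotient_space Z" and "A \<in> quotient_span Z S"
  from this(3) show "A \<in> quotient_space Z"
  proof induction
    case zero
    have "coset Z 0 = Z"
      by (auto simp: coset_def)
    then show ?case
      using coset_in_quotient_space[of Z 0] by simp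
  next
    case (add_scale A B c)
    then obtain x y where "A = coset Z x" "B = coset Z y"
      using S by (auto simp: quotient_space_def)
    then show ?case
      by (simp add: quotient_scale_coset[OF Z] quotient_add_coset[OF Z] coset_in_quotient_space)
  qed
qed

text \<open>\<open>Z\<close> plus the span of the first \<open>n\<close> vectors of
  \<open>d\<close>, in the form treated in \<open>closed_subspace_insert\<close>.\<close>

primrec extend :: "'a::real_normed_vector set \<Rightarrow> (nat \<Rightarrow> 'a) \<Rightarrow> nat \<Rightarrow> 'a set" where
  "extend Z d 0 = Z"
| "extend Z d (Suc n) = {x. \<exists>c. x - c *\<^sub>R d n \<in> extend Z d n}"

lemma extend_closed_subspace:
  assumes "subspace Z" "closed Z"
  shows "subspace (extend Z d n) \<and> closed (extend Z d n)"
  by (induction n) (simp_all add: assms closed_subspace_insert)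

text \<open>The separate bound \<open>N\<close> keeps the generating set fixed during the induction
  on \<open>n\<close>.\<close>

lemma extend_coset_in_span:
  assumes Z: "subspace Z" and "x \<in> extend Z d n" "n \<le> N"
  shows "coset Z x \<in> quotient_span Z ((\<lambda>i. coset Z (d i)) ` {..<N})"
  using assms(2,3)
proof (induction n arbitrary: x)
  case 0
  then have "coset Z x = coset Z 0"
    by (simp add: coset_eq_iff[OF Z])
  moreover have "coset Z 0 = Z"
    by (auto simp: coset_def)
  ultimately show ?case
    by (simp add: quotient_span.zero)
next
  case (Suc n)
  then obtain c where c: "x - c *\<^sub>R d n \<in> extend Z d n" by auto
  have "quotient_add (quotient_scale Z c (coset Z (d n))) (coset Z (x - c *\<^sub>R d n))
      \<in> quotient_span Z ((\<lambda>i. coset Z (d i)) ` {..<N})"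
    using Suc c by (intro quotient_span.add_scale Suc.IH) auto
  then show ?case
    by (simp add: quotient_scale_coset[OF Z] quotient_add_coset[OF Z])
qed

lemma extend_proper:
  assumes Z: "subspace Z" and inf: "\<not> finite_dimensional_quotient Z"
  shows "extend Z d n \<noteq> UNIV"
proof
  assume all: "extend Z d n = UNIV"
  let ?S = "(\<lambda>i. coset Z (d i)) ` {..<n}"
  have S: "finite ?S" "?S \<subseteq> quotient_space Z"
    by (auto simp: coset_in_quotient_space)
  have "coset Z x \<in> quotient_span Z ?S" for x
    by (rule extend_coset_in_span[OF Z _ order_refl]) (simp add: all)
  then have "quotient_space Z \<subseteq> quotient_span Z ?S"
    by (auto simp: quotient_space_def)
  with quotient_span_subset[OF Z S(2)] S inf show False
    unfolding finite_dimensional_quotient_def by blast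
qed

text \<open>The subspaces adjoin the vectors of a dense sequence to \<open>Z\<close> one at a time,
  \<open>v\<close> comes from Baire's theorem and the functionals from Hahn-Banach. Along a
  subsequence \<open>\<sigma>\<close>, \<open>E (\<sigma> m)\<close> has room to lift the earlier
  functionals, so every \<open>x\<close> has a representative of controlled norm in their common
  kernel; \<open>exact_selection\<close> makes the choice continuous.\<close>

lemma ex_seminorm_chain:
  fixes Z :: "'a::banach set"
  assumes Z: "subspace Z" "closed Z"
    and inf: "\<not> finite_dimensional_quotient Z" and sep: "separable_quotient Z"
  shows "\<exists>p h w (v :: 'a). seminorm_chain p h w v 26 1040"
proof -
  obtain d :: "nat \<Rightarrow> 'a" where d: "\<And>x e. 0 < e \<Longrightarrow> \<exists>k. infdist (x - d k) Z < e"
    using separable_quotient_dense_sequence[OF Z sep] by blast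
  define E where "E = extend Z d"
  have E: "subspace (E n)" "closed (E n)" for n
    using extend_closed_subspace[OF Z, of d n] by (simp_all add: E_def)
  have E_Suc: "E n \<subseteq> E (Suc n)" and d_in: "d n \<in> E (Suc n)" for n
    using closed_subspace_insert(3,4)[OF E(1)[of n] E(2)[of n], of "d n"] by (simp_all add: E_def)
  have E_mono: "E m \<subseteq> E n" if "m \<le> n" for m n
    by (rule lift_Suc_mono_le[of E, OF E_Suc that])
  have ne: "E n \<noteq> {}" for n
    using subspace_0[OF E(1)] by auto
  define P where "P n x = infdist x (E n)" for n x
  have P_add: "P n (x + y) \<le> P n x + P n y" and P_scale: "P n (c *\<^sub>R x) = \<bar>c\<bar> * P n x"
    and P_norm: "P n x \<le> norm x" and P_nonneg: "0 \<le> P n x" for n x y c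
    by (simp_all add: P_def infdist_subspace_add infdist_subspace_scale infdist_subspace_le_norm
        infdist_nonneg E)
  have P_mono: "P n x \<le> P m x" if "m \<le> n" for m n x
    unfolding P_def by (rule infdist_mono[OF E_mono[OF that] ne])
  have P_zero: "P n x = 0" if "x \<in> E n" for n x
    using that by (simp add: P_def)
  have P_Z: "P n x \<le> infdist x Z" for n x
    using P_mono[of 0 n x] by (simp add: P_def E_def)
  have small: "\<exists>k. P (Suc k) x < e" if e: "0 < e" for x e
  proof -
    obtain k where k: "infdist (x - d k) Z < e"
      using d[OF e] by blast
    have "P (Suc k) x \<le> P (Suc k) (x - d k) + P (Suc k) (d k)"
      using P_add[of "Suc k" "x - d k" "d k"] by simp
    then show ?thesis
      using P_Z[of "Suc k" "x - d k"] P_zero[OF d_in] k by (intro exI[of _ k]) simp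
  qed
  have dense: "\<exists>n. \<exists>y\<in>E n. norm (x - y) < e" if "0 < e" for x e
    using small[OF that, of x] infdist_near[OF ne] by (metis P_def dist_norm)
  obtain v where v: "norm v \<le> 1" "\<And>n. v \<notin> E n"
    using outside_countable_union[of E] E extend_proper[OF Z(1) inf] by (metis E_def)
  have P_v: "0 < P n v" for n
    unfolding P_def using v(2) infdist_pos_not_in_closed[OF E(2) ne] by blast
  have "sublinear (P n)" for n
    by (simp add: sublinear_def P_add P_scale)
  then have "\<exists>g. linear g \<and> (\<forall>x. g x \<le> P n x) \<and> g v = P n v" for n
    by (rule Hahn_Banach_sublinear)
  then obtain g where g: "\<And>n. linear (g n)" "\<And>n x. g n x \<le> P n x" "\<And>n. g n v = P n v"
    by metis
  have g_abs: "\<bar>g n x\<bar> \<le> P n x" for n x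
    using g(2)[of n x] g(2)[of n "- x"] P_scale[of n "-1" x] linear_neg[OF g(1), of n x] by simp
  have g_norm: "\<bar>g n x\<bar> \<le> norm x" for n x
    using g_abs P_norm by (rule order_trans)
  have "\<exists>n. \<forall>x. \<exists>z\<in>E n. (\<forall>i<N. g i z = g i x) \<and> norm z \<le> 3 * norm x" for N
    by (rule bounded_functional_lift[OF E(1) E_mono dense g(1) g_norm])
  then obtain l where l: "\<And>N x. \<exists>z\<in>E (l N). (\<forall>i<N. g i z = g i x) \<and> norm z \<le> 3 * norm x"
    by metis
  \<comment> \<open>\<open>E (\<sigma> (Suc m))\<close> contains
    \<open>E (l (Suc (\<sigma> m)))\<close> and hence lifts all \<open>g i\<close> with
    \<open>i \<le> \<sigma> m\<close>, among them those kept so far.\<close>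
  define \<sigma> where "\<sigma> = rec_nat 0 (\<lambda>_ s. max (Suc s) (l (Suc s)))"
  have \<sigma>_Suc: "\<sigma> (Suc m) = max (Suc (\<sigma> m)) (l (Suc (\<sigma> m)))" for m
    by (simp add: \<sigma>_def)
  have \<sigma>: "strict_mono \<sigma>"
    by (rule strict_monoI_Suc) (simp add: \<sigma>_Suc)
  have lift: "\<exists>z\<in>E (\<sigma> m). (\<forall>i<m. g (\<sigma> i) z = g (\<sigma> i) x) \<and> norm z \<le> 3 * norm x" for m x
  proof (cases m)
    case 0
    then show ?thesis
      using subspace_0[OF E(1)] by (intro bexI[of _ 0]) auto
  next
    case (Suc k)
    obtain z where z: "z \<in> E (l (Suc (\<sigma> k)))" "\<forall>i<Suc (\<sigma> k). g i z = g i x" "norm z \<le> 3 * norm x"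
      using l by blast
    have "\<sigma> i < Suc (\<sigma> k)" if "i < m" for i
      using that Suc strict_mono_less_eq[OF \<sigma>] by (simp add: less_Suc_eq_le)
    moreover have "z \<in> E (\<sigma> m)"
      using z(1) E_mono[of "l (Suc (\<sigma> k))" "\<sigma> m"] by (auto simp: Suc \<sigma>_Suc)
    ultimately show ?thesis
      using z by blast
  qed
  define p where "p m = P (\<sigma> m)" for m
  define h where "h m = g (\<sigma> m)" for m
  have h_blin: "bounded_linear (h m)" for m
    using g(1)[of "\<sigma> m"] g_norm
    by (intro bounded_linear_intro[where K = 1]) (auto simp: h_def linear_add linear_scale)
  have "\<exists>w. (\<forall>x. isCont w x) \<and> (\<forall>x. p m (w x - x) = 0) \<and> range w \<subseteq> {x. \<forall>i<m. h i x = 0} \<and>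
      (\<forall>x. norm (w x) \<le> 2 * 13 * p m x)" for m
  proof -
    let ?K = "{x. \<forall>i<m. h i x = 0}"
    \<comment> \<open>The witness is \<open>x - a - z\<close>: \<open>a\<close> in
      \<open>E (\<sigma> m)\<close> attains the distance up to a factor 2, and \<open>z\<close> in
      \<open>E (\<sigma> m)\<close> takes the values of the earlier functionals at
      \<open>x - a\<close>. The norm is at most \<open>2 + 3 * 2\<close> times
      \<open>p m x\<close>.\<close>
    have ex_u: "\<exists>u\<in>?K. p m (x - u) = 0 \<and> norm u \<le> 8 * p m x" for x
    proof (cases "p m x = 0")
      case True
      then show ?thesis
        using linear_0[OF g(1)] by (intro bexI[of _ 0]) (auto simp: h_def)
    next
      case False
      then have "infdist x (E (\<sigma> m)) < 2 * p m x"
        using P_nonneg[of "\<sigma> m" x] by (simp add: p_def P_def)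
      then obtain a where a: "a \<in> E (\<sigma> m)" "norm (x - a) < 2 * p m x"
        using infdist_near[OF ne] by (metis dist_norm)
      obtain z where z: "z \<in> E (\<sigma> m)" "\<forall>i<m. g (\<sigma> i) z = g (\<sigma> i) (x - a)" "norm z \<le> 3 * norm (x - a)"
        using lift by blast
      have "x - (x - a - z) \<in> E (\<sigma> m)"
        using subspace_add[OF E(1) a(1) z(1)] by (simp add: algebra_simps)
      then have "p m (x - (x - a - z)) = 0"
        unfolding p_def by (rule P_zero)
      moreover have "norm (x - a - z) \<le> 8 * p m x"
        using norm_triangle_ineq4[of "x - a" z] a(2) z(3) by simp
      moreover have "x - a - z \<in> ?K"
        using z(2) by (simp add: h_def linear_diff[OF g(1)])
      ultimately show ?thesis by blast
    qed
    then have "\<forall>k. \<exists>u. u \<in> ?K \<and> p m (d k - u) = 0 \<and> norm u \<le> 8 * p m (d k)"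
      by blast
    then obtain u where "\<forall>k. u k \<in> ?K \<and> p m (d k - u k) = 0 \<and> norm (u k) \<le> 8 * p m (d k)"
      by (rule choice[THEN exE])
    then have u: "u k \<in> ?K" "p m (d k - u k) = 0" "norm (u k) \<le> 8 * p m (d k)" for k
      by blast+
    show ?thesis
    proof (rule exact_selection[where u = u])
      \<comment> \<open>If \<open>p m (x - d k) < p m x / 2\<close>, then \<open>p m (d k)\<close>
        is below \<open>3 / 2 * p m x\<close>, and 8 times this is below
        \<open>13 * p m x\<close>.\<close>
      show "\<exists>k. p m (x - u k) < p m x / 2 \<and> norm (u k) < 13 * p m x" if x: "0 < p m x" for x
      proof -
        obtain k where "infdist (x - d k) Z < p m x / 2"
          using d[of "p m x / 2" x] x by auto
        then have k: "p m (x - d k) < p m x / 2"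
          using P_Z[of "\<sigma> m" "x - d k"] by (simp add: p_def)
        have "p m (x - u k) \<le> p m (x - d k) + p m (d k - u k)"
          using P_add[of "\<sigma> m" "x - d k" "d k - u k"] by (simp add: p_def)
        moreover have "p m (d k - x) = p m (x - d k)"
          using P_scale[of "\<sigma> m" "-1" "x - d k"] by (simp add: p_def)
        then have "p m (d k) \<le> p m (x - d k) + p m x"
          using P_add[of "\<sigma> m" "d k - x" x] by (simp add: p_def)
        ultimately show ?thesis
          using k u(2,3)[of k] x by (intro exI[of _ k]) auto
      qed
      have K_eq: "?K = (\<Inter>i\<in>{..<m}. {x. h i x = 0})" by auto
      show "closed ?K"
        unfolding K_eq
        by (intro closed_INT ballI closed_Collect_eq continuous_at_imp_continuous_on
            bounded_linear.isCont[OF h_blin] continuous_intros)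
      show "subspace ?K"
        using g(1) by (auto simp: subspace_def h_def linear_0 linear_add linear_scale)
    qed (use u(1) in \<open>auto simp: p_def P_add P_scale P_norm P_nonneg\<close>)
  qed
  then have "\<forall>m. \<exists>w. (\<forall>x. isCont w x) \<and> (\<forall>x. p m (w x - x) = 0) \<and>
      range w \<subseteq> {x. \<forall>i<m. h i x = 0} \<and> (\<forall>x. norm (w x) \<le> 2 * 13 * p m x)"
    by (rule allI)
  then obtain w where "\<forall>m. (\<forall>x. isCont (w m) x) \<and> (\<forall>x. p m (w m x - x) = 0) \<and>
      range (w m) \<subseteq> {x. \<forall>i<m. h i x = 0} \<and> (\<forall>x. norm (w m x) \<le> 2 * 13 * p m x)"
    by (rule choice[THEN exE])
  then have w: "isCont (w m) x" "p m (w m x - x) = 0" "\<forall>i<m. h i (w m x) = 0"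
    "norm (w m x) \<le> 2 * 13 * p m x" for m x
    by auto
  \<comment> \<open>26 is the factor \<open>2 * 13\<close> from \<open>exact_selection\<close>, and
    \<open>1040 = 40 * 26\<close>.\<close>
  have "seminorm_chain p h w v 26 1040"
  proof (rule seminorm_chain.intro)
    show "(\<lambda>n. p n x) \<longlonglongrightarrow> 0" for x
    proof (rule LIMSEQ_I)
      fix e :: real assume "0 < e"
      then obtain k where "P (Suc k) x < e"
        using small by blast
      then have "norm (p n x - 0) < e" if "Suc k \<le> n" for n
        using that P_mono[of "Suc k" "\<sigma> n" x] strict_mono_imp_increasing[OF \<sigma>, of n] P_nonneg
        by (simp add: p_def)
      then show "\<exists>N. \<forall>n\<ge>N. norm (p n x - 0) < e" by blast
    qed
    show "p (Suc n) x \<le> p n x" for n x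
      unfolding p_def using strict_mono_less_eq[OF \<sigma>] by (intro P_mono) simp
    show "h i (w n x) = 0" if "i < n" for i n x
      using w(3) that by blast
    show "norm (w n x) \<le> 26 * p n x" for n x
      using w(4)[of n x] by simp
    show "linear (h n)" for n
      by (simp add: h_def g)
  qed (simp_all add: p_def h_def P_add P_scale P_norm P_v g g_abs v w(1) w(2)[unfolded p_def])
  then show ?thesis by blast
qed

theorem theorem8:
  assumes "has_infinite_dimensional_separable_quotient TYPE('a::banach)"
  shows "\<exists>f :: 'a \<Rightarrow> 'a. continuous_on UNIV f \<and>
    \<not> (\<exists>(I :: real set) (x :: real \<Rightarrow> 'a). open I \<and> is_interval I \<and> I \<noteq> {} \<and>
        (\<forall>t\<in>I. (x has_vector_derivative f (x t)) (at t)))"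
proof -
  obtain Z :: "'a set" where "subspace Z" "closed Z" "\<not> finite_dimensional_quotient Z"
    "separable_quotient Z"
    using assms by (auto simp: has_infinite_dimensional_separable_quotient_def)
  then obtain p h w and v :: 'a where chain: "seminorm_chain p h w v 26 1040"
    using ex_seminorm_chain by blast
  interpret seminorm_chain p h w v 26 1040
    by (rule chain)
  have False if I: "open I" "I \<noteq> {}" and sol: "\<And>t. t \<in> I \<Longrightarrow> (x has_vector_derivative f (x t)) (at t)"
    for I :: "real set" and x
  proof -
    obtain t e where "0 < e" "ball t e \<subseteq> I"
      using I by (meson all_not_in_conv open_contains_ball)
    then have sub: "{t..t + e / 2} \<subseteq> I"
      by (auto simp: subset_iff dist_real_def)
    show False
      by (rule no_solution[of t "t + e / 2" x]) (use \<open>0 < e\<close> sub sol in auto)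
  qed
  with f_continuous show ?thesis by blast
qed

end
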